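(* Let $\Bbbk$ be a field, $n \geq 1$ and $d \geq 2$. The algebra $NC_A(n,d)$ is a Frobenius algebra if and only if $n = 1$ or $d = 2$.
   Context: $NC_A(n,d)$ is the $\Bbbk$-algebra generated by $T_1,\dots,T_n$ with relations $T_iT_{i+1}T_i = T_{i+1}T_iT_{i+1}$ for $0<i<n$, $T_iT_j = T_jT_i$ for $|i-j|>1$, $T_1^2 = \cdots = T_{n-1}^2 = 0$, and $T_n^d = 0$. A finite-dimensional algebra $A$ is Frobenius if it admits a nondegenerate bilinear form $\sigma$ with $\sigma(ab,c) = \sigma(a,bc)$ for all $a,b,c$. *)

theory Defs
  imports Main
begin

text \<open>Free associative algebra over a field on letters (natural numbers), realised as
  functions from words to coefficients (elements of interest have finite support).
  Letter i stands for the generator T_i.\<close>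

type_synonym 'k nca = "nat list \<Rightarrow> 'k"

definition nc_mono :: "nat list \<Rightarrow> 'k::field nca" where
  "nc_mono w = (\<lambda>v. if v = w then 1 else 0)"

definition nc_zero :: "'k::field nca" where "nc_zero = (\<lambda>_. 0)"
definition nc_one :: "'k::field nca" where "nc_one = nc_mono []"
definition nc_add :: "'k::field nca \<Rightarrow> 'k nca \<Rightarrow> 'k nca" where
  "nc_add p q = (\<lambda>w. p w + q w)"
definition nc_sub :: "'k::field nca \<Rightarrow> 'k nca \<Rightarrow> 'k nca" where
  "nc_sub p q = (\<lambda>w. p w - q w)"
definition nc_smult :: "'k::field \<Rightarrow> 'k nca \<Rightarrow> 'k nca" where
  "nc_smult c p = (\<lambda>w. c * p w)"

definition nc_mult :: "'k::field nca \<Rightarrow> 'k nca \<Rightarrow> 'k nca" where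
  "nc_mult p q = (\<lambda>w. \<Sum>i\<le>length w. p (take i w) * q (drop i w))"

primrec nc_pow :: "'k::field nca \<Rightarrow> nat \<Rightarrow> 'k nca" where
  "nc_pow p 0 = nc_one"
| "nc_pow p (Suc k) = nc_mult p (nc_pow p k)"

definition FA :: "nat \<Rightarrow> 'k::field nca set" where
  "FA n = {p. finite {w. p w \<noteq> 0} \<and> (\<forall>w. p w \<noteq> 0 \<longrightarrow> set w \<subseteq> {1..n})}"

definition T :: "nat \<Rightarrow> 'k::field nca" where "T i = nc_mono [i]"

definition NCA_rels :: "nat \<Rightarrow> nat \<Rightarrow> 'k::field nca set" where
  "NCA_rels n d =
     {nc_sub (nc_mult (T i) (nc_mult (T (i+1)) (T i)))
             (nc_mult (T (i+1)) (nc_mult (T i) (T (i+1)))) | i. 0 < i \<and> i < n}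
   \<union> {nc_sub (nc_mult (T i) (T j)) (nc_mult (T j) (T i)) | i j.
        1 \<le> i \<and> i \<le> n \<and> 1 \<le> j \<and> j \<le> n \<and> (i + 1 < j \<or> j + 1 < i)}
   \<union> {nc_pow (T i) 2 | i. 1 \<le> i \<and> i \<le> n - 1}
   \<union> {nc_pow (T n) d}"

inductive_set nc_ideal :: "nat \<Rightarrow> 'k::field nca set \<Rightarrow> 'k nca set" for n R where
  gen: "r \<in> R \<Longrightarrow> r \<in> nc_ideal n R"
| zero: "nc_zero \<in> nc_ideal n R"
| add: "a \<in> nc_ideal n R \<Longrightarrow> b \<in> nc_ideal n R \<Longrightarrow> nc_add a b \<in> nc_ideal n R"
| smult: "a \<in> nc_ideal n R \<Longrightarrow> nc_smult c a \<in> nc_ideal n R"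
| lmult: "a \<in> nc_ideal n R \<Longrightarrow> p \<in> FA n \<Longrightarrow> nc_mult p a \<in> nc_ideal n R"
| rmult: "a \<in> nc_ideal n R \<Longrightarrow> p \<in> FA n \<Longrightarrow> nc_mult a p \<in> nc_ideal n R"

text \<open>NC_A(n,d) = FA n / NCA_ideal n d.\<close>
definition NCA_ideal :: "nat \<Rightarrow> nat \<Rightarrow> 'k::field nca set" where
  "NCA_ideal n d = nc_ideal n (NCA_rels n d)"

definition quot_fin_dim :: "nat \<Rightarrow> 'k::field nca set \<Rightarrow> bool" where
  "quot_fin_dim n I \<longleftrightarrow> (\<exists>B. finite B \<and> B \<subseteq> FA n \<and>
     (\<forall>p\<in>FA n. \<exists>c. nc_sub p (\<lambda>w. \<Sum>b\<in>B. c b * b w) \<in> I))"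

text \<open>Frobenius structure on FA n / I, described via bilinear forms on FA n that descend to
  the quotient (vanish when either argument lies in I); nondegeneracy is stated on the
  quotient (radicals equal I).\<close>
definition quot_Frobenius :: "nat \<Rightarrow> 'k::field nca set \<Rightarrow> bool" where
  "quot_Frobenius n I \<longleftrightarrow> quot_fin_dim n I \<and>
   (\<exists>\<sigma> :: 'k nca \<Rightarrow> 'k nca \<Rightarrow> 'k.
      (\<forall>a\<in>FA n. \<forall>b\<in>FA n. \<forall>c\<in>FA n.
          \<sigma> (nc_add a b) c = \<sigma> a c + \<sigma> b c \<and> \<sigma> c (nc_add a b) = \<sigma> c a + \<sigma> c b) \<and>
      (\<forall>a\<in>FA n. \<forall>b\<in>FA n. \<forall>s. \<sigma> (nc_smult s a) b = s * \<sigma> a b \<and> \<sigma> a (nc_smult s b) = s * \<sigma> a b) \<and>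
      (\<forall>a\<in>I. \<forall>b\<in>FA n. \<sigma> a b = 0 \<and> \<sigma> b a = 0) \<and>
      (\<forall>a\<in>FA n. \<forall>b\<in>FA n. \<forall>c\<in>FA n. \<sigma> (nc_mult a b) c = \<sigma> a (nc_mult b c)) \<and>
      (\<forall>a\<in>FA n. (\<forall>b\<in>FA n. \<sigma> a b = 0) \<longrightarrow> a \<in> I) \<and>
      (\<forall>b\<in>FA n. (\<forall>a\<in>FA n. \<sigma> a b = 0) \<longrightarrow> b \<in> I))"

end

theory Submission
  imports Defs
begin

text \<open>
  All relations are of the form \<open>u = v\<close> or \<open>u = 0\<close> for words \<open>u\<close>, \<open>v\<close>, so any partial action of the
  letters on a set of states that satisfies them yields linear functionals vanishing on the ideal.

  For \<open>d = 2\<close>, let \<open>T_i\<close> act on a permutation by swapping positions \<open>i\<close> and \<open>i + 1\<close> if this is an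
  ascent, and by zero otherwise. The words \<open>u_1 \<dots> u_n\<close> with \<open>u_m = m (m - 1) \<dots> k\<close> span the quotient
  and lead from the identity to distinct permutations. The coefficient of the longest permutation is a
  Frobenius functional. For \<open>n = 1\<close> the top coefficient of the truncated polynomial ring is one.

  If \<open>n \<ge> 2\<close> and \<open>d \<ge> 3\<close>, then \<open>T_n T_n T_(n-1) T_n = 0\<close>, hence \<open>x = T_n T_n T_w\<close> with \<open>w\<close> the longest
  element of the symmetric group generated by the letters below \<open>n\<close> is annihilated by every generator
  from the right, and so is \<open>y = T_(n-1) x\<close>. A Frobenius form on a local algebra allows only a
  one-dimensional socle, but a suitable action shows that \<open>x\<close> and \<open>y\<close> are linearly independent.
\<close>

section \<open>Linear functionals on the free algebra\<close>

text \<open>The linear extension of \<open>g\<close> from words to polynomials. A sum over an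
  infinite set defaults to 0, hence the assumptions \<open>fin_supp\<close> in the rules
  below.\<close>

definition nc_eval :: "'k::field nca \<Rightarrow> (nat list \<Rightarrow> 'k) \<Rightarrow> 'k" where
  "nc_eval p g = (\<Sum>w | p w \<noteq> 0. p w * g w)"

abbreviation fin_supp :: "'k::field nca \<Rightarrow> bool" where
  "fin_supp p \<equiv> finite {w. p w \<noteq> 0}"

lemma nc_eval_superset:
  assumes "finite S" "\<And>w. p w \<noteq> 0 \<Longrightarrow> w \<in> S"
  shows "nc_eval p g = (\<Sum>w\<in>S. p w * g w)"
  unfolding nc_eval_def by (rule sum.mono_neutral_left) (use assms in auto)

lemma nc_eval_zero_right [simp]: "nc_eval p (\<lambda>_. 0) = 0"
  by (simp add: nc_eval_def)

lemma nc_eval_zero [simp]: "nc_eval nc_zero g = 0"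
  by (simp add: nc_eval_def nc_zero_def)

lemma nc_eval_mono [simp]: "nc_eval (nc_mono u) g = g u"
  by (subst nc_eval_superset[of "{u}"]) (auto simp: nc_mono_def split: if_splits)

lemma fin_supp_mono [simp]: "fin_supp (nc_mono u :: 'k::field nca)"
  by (rule finite_subset[of _ "{u}"]) (auto simp: nc_mono_def)

lemma fin_supp_zero [simp]: "fin_supp nc_zero"
  by (simp add: nc_zero_def)

lemma fin_supp_add [simp]: "fin_supp p \<Longrightarrow> fin_supp q \<Longrightarrow> fin_supp (nc_add p q)"
  by (rule finite_subset[of _ "{w. p w \<noteq> 0} \<union> {w. q w \<noteq> 0}"]) (auto simp: nc_add_def)

lemma fin_supp_smult [simp]: "fin_supp p \<Longrightarrow> fin_supp (nc_smult c p)"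
  by (rule finite_subset[of _ "{w. p w \<noteq> 0}"]) (auto simp: nc_smult_def)

lemma nc_sub_eq: "nc_sub p q = nc_add p (nc_smult (-1) q)"
  by (auto simp: nc_sub_def nc_add_def nc_smult_def)

lemma fin_supp_sub [simp]: "fin_supp p \<Longrightarrow> fin_supp q \<Longrightarrow> fin_supp (nc_sub p q)"
  unfolding nc_sub_eq by simp

lemma nc_mult_support:
  "{w. nc_mult p q w \<noteq> 0} \<subseteq> (\<lambda>(u, v). u @ v) ` ({w. p w \<noteq> 0} \<times> {w. q w \<noteq> 0})"
proof
  fix w assume "w \<in> {w. nc_mult p q w \<noteq> 0}"
  then have "\<exists>i\<in>{..length w}. p (take i w) * q (drop i w) \<noteq> 0"
    unfolding nc_mult_def by (metis (mono_tags, lifting) mem_Collect_eq sum.neutral)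
  then obtain i where "p (take i w) \<noteq> 0" "q (drop i w) \<noteq> 0" by auto
  then show "w \<in> (\<lambda>(u, v). u @ v) ` ({w. p w \<noteq> 0} \<times> {w. q w \<noteq> 0})"
    by (intro image_eqI[of _ _ "(take i w, drop i w)"]) auto
qed

lemma fin_supp_mult [simp]: "fin_supp p \<Longrightarrow> fin_supp q \<Longrightarrow> fin_supp (nc_mult p q)"
  by (rule finite_subset[OF nc_mult_support]) auto

lemma nc_eval_add:
  assumes "fin_supp p" "fin_supp q"
  shows "nc_eval (nc_add p q) g = nc_eval p g + nc_eval q g"
proof -
  let ?S = "{w. p w \<noteq> 0} \<union> {w. q w \<noteq> 0}"
  have fin: "finite ?S" using assms by simp
  have "nc_eval (nc_add p q) g = (\<Sum>w\<in>?S. nc_add p q w * g w)"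
    by (rule nc_eval_superset[OF fin]) (auto simp: nc_add_def)
  moreover have "nc_eval p g = (\<Sum>w\<in>?S. p w * g w)" "nc_eval q g = (\<Sum>w\<in>?S. q w * g w)"
    by (rule nc_eval_superset[OF fin]; simp)+
  ultimately show ?thesis
    by (simp add: nc_add_def distrib_right sum.distrib)
qed

lemma nc_eval_smult:
  assumes "fin_supp p"
  shows "nc_eval (nc_smult c p) g = c * nc_eval p g"
  using nc_eval_superset[of "{w. p w \<noteq> 0}" "nc_smult c p" g]
        nc_eval_superset[of "{w. p w \<noteq> 0}" p g] assms
  by (simp add: nc_smult_def sum_distrib_left mult.assoc)

lemma nc_eval_sub:
  "fin_supp p \<Longrightarrow> fin_supp q \<Longrightarrow> nc_eval (nc_sub p q) g = nc_eval p g - nc_eval q g"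
  unfolding nc_sub_eq by (simp add: nc_eval_add nc_eval_smult)

text \<open>Convolution sums over cuts \<open>(w, i)\<close> of words, and the relevant cuts
  correspond to pairs of words from the two supports. Products can thus be treated as nested
  functionals.\<close>

lemma nc_eval_mult:
  assumes "fin_supp p" "fin_supp q"
  shows "nc_eval (nc_mult p q) g = nc_eval p (\<lambda>u. nc_eval q (\<lambda>v. g (u @ v)))"
proof -
  let ?P = "{w. p w \<noteq> 0}" and ?Q = "{w. q w \<noteq> 0}"
  let ?S = "(\<lambda>(u, v). u @ v) ` (?P \<times> ?Q)"
  have fin: "finite ?S" using assms by simp
  have "nc_eval (nc_mult p q) g = (\<Sum>w\<in>?S. nc_mult p q w * g w)"
    by (rule nc_eval_superset[OF fin]) (use nc_mult_support[of p q] in auto)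
  also have "\<dots> = (\<Sum>w\<in>?S. \<Sum>i\<in>{..length w}. p (take i w) * q (drop i w) * g w)"
    unfolding nc_mult_def by (simp add: sum_distrib_right)
  also have "\<dots> = (\<Sum>(w, i)\<in>Sigma ?S (\<lambda>w. {..length w}). p (take i w) * q (drop i w) * g w)"
    using fin by (subst sum.Sigma) auto
  \<comment> \<open>All other cuts have a factor outside its support. Recording the cut position
    makes \<open>(u, v)\<close> recoverable, so that the reindexing further down is
    injective.\<close>
  also have "\<dots> = (\<Sum>(w, i)\<in>(\<lambda>(u, v). (u @ v, length u)) ` (?P \<times> ?Q).
      p (take i w) * q (drop i w) * g w)"
  proof (rule sum.mono_neutral_right)
    show "\<forall>x\<in>Sigma ?S (\<lambda>w. {..length w}) - (\<lambda>(u, v). (u @ v, length u)) ` (?P \<times> ?Q).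
        (case x of (w, i) \<Rightarrow> p (take i w) * q (drop i w) * g w) = 0"
    proof (intro ballI, elim DiffE, clarify)
      fix w i assume i: "i \<le> length w"
        and out: "(w, i) \<notin> (\<lambda>(u, v). (u @ v, length u)) ` (?P \<times> ?Q)"
      have "(take i w, drop i w) \<notin> ?P \<times> ?Q"
        using i out image_eqI[of "(w, i)" "\<lambda>(u, v). (u @ v, length u)" "(take i w, drop i w)" "?P \<times> ?Q"]
        by auto
      then show "p (take i w) * q (drop i w) * g w = 0" by auto
    qed
  qed (use fin in auto)
  also have "\<dots> = (\<Sum>(u, v)\<in>?P \<times> ?Q. p u * q v * g (u @ v))"
    by (subst sum.reindex) (auto intro!: inj_onI sum.cong)
  also have "\<dots> = (\<Sum>u\<in>?P. \<Sum>v\<in>?Q. p u * q v * g (u @ v))"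
    using assms by (subst sum.Sigma) auto
  finally show ?thesis
    by (simp add: nc_eval_def sum_distrib_left mult.assoc)
qed

lemma nc_mult_mono [simp]:
  "nc_mult (nc_mono u) (nc_mono v) = (nc_mono (u @ v) :: 'k::field nca)"
proof
  fix w
  \<comment> \<open>A coefficient is the value of an indicator functional, so
    \<open>nc_eval_mult\<close> computes the product.\<close>
  have *: "p w = nc_eval p (\<lambda>v. if v = w then 1 else 0)" if "fin_supp p" for p :: "'k nca"
    using nc_eval_superset[of "insert w {w. p w \<noteq> 0}" p] that
    by (simp add: if_distrib cong: if_cong)
  show "nc_mult (nc_mono u) (nc_mono v) w = (nc_mono (u @ v) w :: 'k)"
    by (subst (1 2) *) (simp_all add: nc_eval_mult)
qed

lemma nc_mult_sub_right: "nc_mult p (nc_sub q r) = nc_sub (nc_mult p q) (nc_mult p r)"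
  by (auto simp: nc_mult_def nc_sub_def right_diff_distrib sum_subtractf)

lemma nc_mult_sub_left: "nc_mult (nc_sub q r) p = nc_sub (nc_mult q p) (nc_mult r p)"
  by (auto simp: nc_mult_def nc_sub_def left_diff_distrib sum_subtractf)

lemma nc_mult_add_right: "nc_mult p (nc_add q r) = nc_add (nc_mult p q) (nc_mult p r)"
  by (auto simp: nc_mult_def nc_add_def distrib_left sum.distrib)

lemma nc_mult_smult_right: "nc_mult p (nc_smult c q) = nc_smult c (nc_mult p q)"
  by (auto simp: nc_mult_def nc_smult_def sum_distrib_left mult_ac intro!: sum.cong)

lemma nc_mult_smult_left: "nc_mult (nc_smult c p) q = nc_smult c (nc_mult p q)"
  by (auto simp: nc_mult_def nc_smult_def sum_distrib_left mult_ac intro!: sum.cong)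

lemma nc_pow_mono: "nc_pow (nc_mono [i]) k = nc_mono (replicate k i)"
  by (induction k) (auto simp: nc_one_def)

section \<open>Polynomials in the letters up to \<open>n\<close>\<close>

lemma FA_fin_supp [dest]: "p \<in> FA n \<Longrightarrow> fin_supp p"
  by (simp add: FA_def)

lemma mono_in_FA: "(nc_mono w :: 'k::field nca) \<in> FA n \<longleftrightarrow> set w \<subseteq> {1..n}"
  by (auto simp: FA_def) (auto simp: nc_mono_def split: if_splits)

lemma FA_add:
  assumes "p \<in> FA n" "q \<in> FA n"
  shows "nc_add p q \<in> FA n"
proof -
  have "set w \<subseteq> {1..n}" if "nc_add p q w \<noteq> 0" for w
  proof -
    from that have "p w \<noteq> 0 \<or> q w \<noteq> 0" by (auto simp: nc_add_def)
    then show ?thesis using assms unfolding FA_def by blast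
  qed
  then show ?thesis using assms[THEN FA_fin_supp] fin_supp_add[of p q] unfolding FA_def by simp
qed

lemma FA_smult: "p \<in> FA n \<Longrightarrow> nc_smult c p \<in> FA n"
  unfolding FA_def using fin_supp_smult[of p c] by (fastforce simp: nc_smult_def)

lemma FA_mult:
  assumes "p \<in> FA n" "q \<in> FA n"
  shows "nc_mult p q \<in> FA n"
  using nc_mult_support[of p q] assms fin_supp_mult[of p q] unfolding FA_def by fastforce

lemma FA_induct [consumes 1, case_names zero add]:
  assumes "p \<in> FA n"
    and "P nc_zero"
    and "\<And>c w q. set w \<subseteq> {1..n} \<Longrightarrow> q \<in> FA n \<Longrightarrow> P q \<Longrightarrow> P (nc_add (nc_smult c (nc_mono w)) q)"
  shows "P p"
proof -
  \<comment> \<open>The induction runs over a finite set containing the support and takes off one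
    word at a time.\<close>
  have "finite S \<Longrightarrow> \<forall>p. p \<in> FA n \<longrightarrow> {w. p w \<noteq> 0} \<subseteq> S \<longrightarrow> P p" for S
  proof (induction S rule: finite_induct)
    case empty
    have "p = nc_zero" if "{w. p w \<noteq> 0} \<subseteq> {}" for p :: "'a nca"
      using that by (auto simp: nc_zero_def)
    then show ?case using assms(2) by blast
  next
    case (insert x S)
    show ?case
    proof (intro allI impI)
      fix p :: "'a nca" assume p: "p \<in> FA n" "{w. p w \<noteq> 0} \<subseteq> insert x S"
      let ?q = "p(x := 0)"
      have "{w. ?q w \<noteq> 0} \<subseteq> {w. p w \<noteq> 0}" by auto
      then have q: "?q \<in> FA n"
        using p(1) unfolding FA_def by (auto intro: finite_subset)
      have "{w. ?q w \<noteq> 0} \<subseteq> S" using p(2) by auto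
      then have Pq: "P ?q" using insert.IH q by blast
      have eq: "p = nc_add (nc_smult (p x) (nc_mono x)) ?q"
        by (auto simp: nc_add_def nc_smult_def nc_mono_def)
      \<comment> \<open>Only a word with nonzero coefficient is known to have its letters in
        \<open>1..n\<close>, so a zero coefficient needs its own case.\<close>
      show "P p"
      proof (cases "p x = 0")
        case True
        then have "?q = p" by auto
        with Pq show ?thesis by simp
      next
        case False
        then have "set x \<subseteq> {1..n}" using p(1) by (auto simp: FA_def)
        from assms(3)[OF this q Pq, of "p x"] eq show ?thesis by simp
      qed
    qed
  qed
  then show ?thesis using assms(1) by (auto simp: FA_def)
qed

section \<open>Reversal of words\<close>

definition nc_rev :: "'k::field nca \<Rightarrow> 'k nca" where
  "nc_rev p = (\<lambda>w. p (rev w))"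

lemma nc_rev_rev [simp]: "nc_rev (nc_rev p) = p"
  by (simp add: nc_rev_def)

lemma nc_rev_mono [simp]: "nc_rev (nc_mono u) = nc_mono (rev u)"
  by (auto simp: nc_rev_def nc_mono_def fun_eq_iff)

lemma nc_rev_sub: "nc_rev (nc_sub p q) = nc_sub (nc_rev p) (nc_rev q)"
  by (simp add: nc_rev_def nc_sub_def)

text \<open>Reversal is an anti-automorphism because a cut at \<open>i\<close> becomes a cut at
  \<open>length w - i\<close>. It trades left for right multiplication.\<close>

lemma nc_rev_mult: "nc_rev (nc_mult p q) = nc_mult (nc_rev q) (nc_rev p)"
proof
  fix w :: "nat list"
  show "nc_rev (nc_mult p q) w = nc_mult (nc_rev q) (nc_rev p) w"
    unfolding nc_rev_def nc_mult_def
    by (rule sum.reindex_bij_witness[where i = "\<lambda>i. length w - i" and j = "\<lambda>i. length w - i"])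
       (auto simp: rev_take rev_drop mult.commute)
qed

lemma fin_supp_rev: "fin_supp p \<Longrightarrow> fin_supp (nc_rev p)"
  by (rule finite_subset[of _ "rev ` {w. p w \<noteq> 0}"]) 
     (auto simp: nc_rev_def intro: image_eqI[of _ rev "rev _"])

lemma FA_rev: "p \<in> FA n \<Longrightarrow> nc_rev p \<in> FA n"
  using fin_supp_rev[of p] unfolding FA_def by (fastforce simp: nc_rev_def)

lemma nc_eval_rev: "nc_eval (nc_rev p) g = nc_eval p (\<lambda>w. g (rev w))"
  unfolding nc_eval_def nc_rev_def
  by (rule sum.reindex_bij_witness[where i = rev and j = rev]) auto

lemma nc_ideal_rev:
  assumes "a \<in> nc_ideal n R" and R: "\<And>r. r \<in> R \<Longrightarrow> nc_rev r \<in> R"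
  shows "nc_rev a \<in> nc_ideal n R"
  using assms(1)
proof (induction rule: nc_ideal.induct)
  case (gen r)
  then show ?case by (intro nc_ideal.gen R)
next
  case zero
  then show ?case using nc_ideal.zero by (simp add: nc_rev_def nc_zero_def)
next
  case (add a b)
  then show ?case using nc_ideal.add[of "nc_rev a" n R "nc_rev b"] by (simp add: nc_rev_def nc_add_def)
next
  case (smult a c)
  then show ?case using nc_ideal.smult[of "nc_rev a" n R c] by (simp add: nc_rev_def nc_smult_def)
next
  case (lmult a p)
  then show ?case by (simp add: nc_rev_mult nc_ideal.rmult FA_rev)
next
  case (rmult a p)
  then show ?case by (simp add: nc_rev_mult nc_ideal.lmult FA_rev)
qed

section \<open>Partial actions on states\<close>

text \<open>\<open>None\<close> plays the role of zero. The first letter acts first, so this is a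
  right action of words.\<close>

primrec run :: "(nat \<Rightarrow> 's \<Rightarrow> 's option) \<Rightarrow> nat list \<Rightarrow> 's \<Rightarrow> 's option" where
  "run \<delta> [] s = Some s"
| "run \<delta> (i # w) s = Option.bind (\<delta> i s) (run \<delta> w)"

lemma run_append: "run \<delta> (u @ v) s = Option.bind (run \<delta> u s) (run \<delta> v)"
  by (induction u arbitrary: s) (auto split: Option.bind_split)

text \<open>Quantifying over all functions \<open>\<phi>\<close> on states, rather than over indicators of single states,
  is what makes the claim stable under right multiplication.\<close>

lemma nc_ideal_eval_run:
  fixes R :: "'k::field nca set"
  assumes "a \<in> nc_ideal n R"
    and fin: "\<And>r. r \<in> R \<Longrightarrow> fin_supp r"
    and R: "\<And>r s \<phi>. r \<in> R \<Longrightarrow> \<phi> None = 0 \<Longrightarrow> nc_eval r (\<lambda>w. \<phi> (run \<delta> w s)) = 0"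
  shows "fin_supp a \<and> (\<forall>s \<phi>. \<phi> None = 0 \<longrightarrow> nc_eval a (\<lambda>w. \<phi> (run \<delta> w s)) = 0)"
  using assms(1)
proof (induction rule: nc_ideal.induct)
  case (gen r)
  then show ?case using fin R by blast
next
  case zero
  then show ?case by simp
next
  case (add a b)
  then show ?case by (simp add: nc_eval_add)
next
  case (smult a c)
  then show ?case by (simp add: nc_eval_smult)
next
  case (lmult a p)
  have "nc_eval (nc_mult p a) (\<lambda>w. \<phi> (run \<delta> w s)) = 0" if "\<phi> None = 0" for s and \<phi> :: "_ \<Rightarrow> 'k"
  proof -
    \<comment> \<open>The prefix \<open>u\<close> either kills the state, where
      \<open>\<phi>\<close> is 0, or leads to another state, to which the induction hypothesis
      applies.\<close>
    have "nc_eval a (\<lambda>v. \<phi> (run \<delta> (u @ v) s)) = 0" for u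
      using lmult.IH that by (cases "run \<delta> u s") (auto simp: run_append)
    then show ?thesis
      using lmult by (simp add: nc_eval_mult FA_fin_supp)
  qed
  then show ?case using lmult by (auto simp: FA_fin_supp)
next
  case (rmult a p)
  have "nc_eval (nc_mult a p) (\<lambda>w. \<phi> (run \<delta> w s)) = 0" if "\<phi> None = 0" for s and \<phi> :: "_ \<Rightarrow> 'k"
  proof -
    \<comment> \<open>The right factor is absorbed into a new test function, which still vanishes at
      \<open>None\<close>.\<close>
    let ?\<psi> = "\<lambda>x. nc_eval p (\<lambda>v. \<phi> (Option.bind x (run \<delta> v)))"
    have "nc_eval a (\<lambda>u. ?\<psi> (run \<delta> u s)) = 0"
      using rmult.IH[THEN conjunct2, rule_format, of ?\<psi> s] that by simp
    then show ?thesis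
      using rmult by (simp add: nc_eval_mult FA_fin_supp run_append)
  qed
  then show ?case using rmult by (auto simp: FA_fin_supp)
qed

section \<open>Monomials modulo an ideal\<close>

locale nc_two_sided_ideal =
  fixes n :: nat and I :: "'k::field nca set"
  assumes zero: "nc_zero \<in> I"
    and add: "a \<in> I \<Longrightarrow> b \<in> I \<Longrightarrow> nc_add a b \<in> I"
    and smult: "a \<in> I \<Longrightarrow> nc_smult c a \<in> I"
    and lmult: "a \<in> I \<Longrightarrow> p \<in> FA n \<Longrightarrow> nc_mult p a \<in> I"
    and rmult: "a \<in> I \<Longrightarrow> p \<in> FA n \<Longrightarrow> nc_mult a p \<in> I"
begin

definition vanishes :: "nat list \<Rightarrow> bool" where
  "vanishes w \<longleftrightarrow> nc_mono w \<in> I"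

definition cong :: "nat list \<Rightarrow> nat list \<Rightarrow> bool" (infix "\<approx>" 50) where
  "u \<approx> v \<longleftrightarrow> nc_sub (nc_mono u) (nc_mono v) \<in> I"

lemma cong_refl [simp, intro]: "u \<approx> u"
  using zero by (simp add: cong_def nc_sub_def nc_zero_def)

lemma cong_sym: "u \<approx> v \<Longrightarrow> v \<approx> u"
  unfolding cong_def using smult[of "nc_sub (nc_mono u) (nc_mono v)" "-1"]
  by (simp add: nc_sub_def nc_smult_def)

lemma cong_trans [trans]: "u \<approx> v \<Longrightarrow> v \<approx> w \<Longrightarrow> u \<approx> w"
  unfolding cong_def using add[of "nc_sub (nc_mono u) (nc_mono v)" "nc_sub (nc_mono v) (nc_mono w)"]
  by (simp add: nc_sub_def nc_add_def)

lemma vanishes_cong: "u \<approx> v \<Longrightarrow> vanishes v \<Longrightarrow> vanishes u"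
  unfolding cong_def vanishes_def
  using add[of "nc_sub (nc_mono u) (nc_mono v)" "nc_mono v"]
  by (simp add: nc_sub_def nc_add_def)

lemma cong_context:
  assumes "u \<approx> v" "set a \<subseteq> {1..n}" "set b \<subseteq> {1..n}"
  shows "a @ u @ b \<approx> a @ v @ b"
proof -
  have "nc_mult (nc_mono a) (nc_mult (nc_sub (nc_mono u) (nc_mono v)) (nc_mono b)) \<in> I"
    using assms by (intro lmult rmult) (auto simp: cong_def mono_in_FA)
  then show ?thesis
    by (simp add: nc_mult_sub_left nc_mult_sub_right cong_def)
qed

lemma cong_append_left: "u \<approx> v \<Longrightarrow> set a \<subseteq> {1..n} \<Longrightarrow> a @ u \<approx> a @ v"
  using cong_context[of u v a "[]"] by simp

lemma cong_append_right: "u \<approx> v \<Longrightarrow> set b \<subseteq> {1..n} \<Longrightarrow> u @ b \<approx> v @ b"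
  using cong_context[of u v "[]" b] by simp

lemma vanishes_context:
  assumes "vanishes u" "set a \<subseteq> {1..n}" "set b \<subseteq> {1..n}"
  shows "vanishes (a @ u @ b)"
proof -
  have "nc_mult (nc_mono a) (nc_mult (nc_mono u) (nc_mono b)) \<in> I"
    using assms by (intro lmult rmult) (auto simp: vanishes_def mono_in_FA)
  then show ?thesis by (simp add: vanishes_def)
qed

lemma vanishes_append_left: "vanishes u \<Longrightarrow> set a \<subseteq> {1..n} \<Longrightarrow> vanishes (a @ u)"
  using vanishes_context[of u a "[]"] by simp

lemma vanishes_append_right: "vanishes u \<Longrightarrow> set b \<subseteq> {1..n} \<Longrightarrow> vanishes (u @ b)"
  using vanishes_context[of u "[]" b] by simp

lemma span_by_words:
  assumes "finite N"
    and red: "\<And>w. set w \<subseteq> {1..n} \<Longrightarrow> vanishes w \<or> (\<exists>u\<in>N. w \<approx> u)"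
    and "p \<in> FA n"
  shows "\<exists>c. nc_sub p (\<lambda>w. \<Sum>u\<in>N. c u * nc_mono u w) \<in> I"
  using assms(3)
proof (induction rule: FA_induct)
  case zero
  then show ?case using nc_two_sided_ideal.zero[OF nc_two_sided_ideal_axioms]
    by (intro exI[of _ "\<lambda>_. 0"]) (simp add: nc_sub_def nc_zero_def)
next
  case (add c w q)
  then obtain e where e: "nc_sub q (\<lambda>w. \<Sum>u\<in>N. e u * nc_mono u w) \<in> I" (is "?q \<in> I") by blast
  note I_add = nc_two_sided_ideal.add[OF nc_two_sided_ideal_axioms]
  from red[OF add.hyps(1)] show ?case
  proof
    assume "vanishes w"
    then have "nc_add (nc_smult c (nc_mono w)) ?q \<in> I"
      unfolding vanishes_def by (intro I_add smult e)
    then show ?thesis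
      by (intro exI[of _ e]) (simp add: nc_add_def nc_sub_def algebra_simps)
  next
    assume "\<exists>u\<in>N. w \<approx> u"
    then obtain u where u: "u \<in> N" "w \<approx> u" by blast
    have "nc_add (nc_smult c (nc_sub (nc_mono w) (nc_mono u))) ?q \<in> I"
      using u(2) unfolding cong_def by (intro I_add smult e)
    \<comment> \<open>Replacing \<open>w\<close> by its representative \<open>u\<close> just raises
      the coefficient of \<open>u\<close> by \<open>c\<close>.\<close>
    moreover have "(\<Sum>v\<in>N. (e(u := e u + c)) v * nc_mono v x)
        = (\<Sum>v\<in>N. e v * nc_mono v x) + c * nc_mono u x" for x
    proof -
      have "(\<Sum>v\<in>N. (e(u := e u + c)) v * nc_mono v x)
          = (\<Sum>v\<in>N. e v * nc_mono v x + (if v = u then c * nc_mono u x else 0))"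
        by (rule sum.cong) (auto simp: algebra_simps)
      then show ?thesis using u(1) assms(1) by (simp add: sum.distrib)
    qed
    ultimately show ?thesis
      by (intro exI[of _ "e(u := e u + c)"])
         (simp add: nc_add_def nc_sub_def nc_smult_def algebra_simps)
  qed
qed

text \<open>A functional that separates a finite spanning set of words by right multiplication, and that is
  invariant under reversal, is a Frobenius functional: reversal turns nondegeneracy on one side into
  nondegeneracy on the other.\<close>

theorem Frobenius_criterion:
  fixes g :: "nat list \<Rightarrow> 'k"
  assumes fin: "finite N" and NFA: "\<And>u. u \<in> N \<Longrightarrow> set u \<subseteq> {1..n}"
    and red: "\<And>w. set w \<subseteq> {1..n} \<Longrightarrow> vanishes w \<or> (\<exists>u\<in>N. w \<approx> u)"
    and I_fin: "\<And>a. a \<in> I \<Longrightarrow> fin_supp a"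
    and I_eval: "\<And>a. a \<in> I \<Longrightarrow> nc_eval a g = 0"
    and sep: "\<And>u. u \<in> N \<Longrightarrow>
      \<exists>v. set v \<subseteq> {1..n} \<and> (\<forall>u'\<in>N. g (u' @ v) = (if u' = u then 1 else 0))"
    and I_rev: "\<And>a. a \<in> I \<Longrightarrow> nc_rev a \<in> I"
    and g_rev: "\<And>w. set w \<subseteq> {1..n} \<Longrightarrow> g (rev w) = g w"
  shows "quot_Frobenius n I"
proof -
  \<comment> \<open>With the form taken as \<open>g\<close> of the product, associativity comes for
    free and only nondegeneracy needs work.\<close>
  define \<sigma> where "\<sigma> a b = nc_eval (nc_mult a b) g" for a b
  have \<sigma>: "\<sigma> a b = nc_eval a (\<lambda>u. nc_eval b (\<lambda>v. g (u @ v)))" if "fin_supp a" "fin_supp b" for a b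
    unfolding \<sigma>_def by (rule nc_eval_mult[OF that])
  have left: "a \<in> I" if a: "a \<in> FA n" and van: "\<forall>b\<in>FA n. \<sigma> a b = 0" for a
  proof -
    obtain c where c: "nc_sub a (\<lambda>w. \<Sum>u\<in>N. c u * nc_mono u w) \<in> I" (is "nc_sub a ?s \<in> I")
      using span_by_words[OF fin red a] by blast
    have supp_s: "w \<in> N" if "?s w \<noteq> 0" for w
    proof (rule ccontr)
      assume "w \<notin> N"
      then have "?s w = 0" by (intro sum.neutral) (auto simp: nc_mono_def)
      with that show False by simp
    qed
    have s_eq: "?s w = c w" if "w \<in> N" for w
    proof -
      have "?s w = (\<Sum>u\<in>N. if u = w then c w else 0)"
        by (rule sum.cong) (auto simp: nc_mono_def)
      then show ?thesis using that fin by simp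
    qed
    have s_fin: "fin_supp ?s"
      using supp_s fin by (auto intro: finite_subset[of _ N])
    \<comment> \<open>Multiply the difference of \<open>a\<close> and its representative by the word
      \<open>v\<close> separating \<open>u\<close>: the functional kills the result,
      \<open>a\<close> contributes 0 by assumption, and the representative contributes
      \<open>c u\<close>.\<close>
    have "c u = 0" if "u \<in> N" for u
    proof -
      obtain v where v: "set v \<subseteq> {1..n}" "\<forall>u'\<in>N. g (u' @ v) = (if u' = u then 1 else 0)"
        using sep[OF \<open>u \<in> N\<close>] by blast
      have v': "nc_mono v \<in> FA n" using v(1) by (simp add: mono_in_FA)
      have "nc_eval (nc_mult (nc_sub a ?s) (nc_mono v)) g = 0"
        by (intro I_eval rmult c v')
      then have "nc_eval a (\<lambda>u. g (u @ v)) - nc_eval ?s (\<lambda>u. g (u @ v)) = 0"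
        using a s_fin by (simp add: nc_eval_mult nc_eval_sub FA_fin_supp)
      moreover have "nc_eval a (\<lambda>u. g (u @ v)) = 0"
        using bspec[OF van v'] \<sigma>[of a "nc_mono v"] a by (simp add: FA_fin_supp)
      moreover have "nc_eval ?s (\<lambda>u. g (u @ v)) = (\<Sum>w\<in>N. ?s w * g (w @ v))"
        by (rule nc_eval_superset[OF fin supp_s])
      moreover have "\<dots> = (\<Sum>w\<in>N. if w = u then c u else 0)"
        by (rule sum.cong) (use v(2) s_eq in auto)
      ultimately show ?thesis using fin that by simp
    qed
    then have "?s = nc_zero" by (auto simp: nc_zero_def)
    with c show ?thesis by (simp add: nc_sub_def nc_zero_def)
  qed
  have rev_eval: "nc_eval (nc_rev p) g = nc_eval p g" if "p \<in> FA n" for p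
    unfolding nc_eval_rev using that unfolding nc_eval_def FA_def
    by (intro sum.cong) (auto simp: g_rev)
  have right: "b \<in> I" if b: "b \<in> FA n" and van: "\<forall>a\<in>FA n. \<sigma> a b = 0" for b
  proof -
    have "\<sigma> (nc_rev b) a = 0" if "a \<in> FA n" for a
    proof -
      \<comment> \<open>Hence pairing \<open>nc_rev b\<close> with \<open>a\<close> equals pairing
        \<open>nc_rev a\<close> with \<open>b\<close>, which moves \<open>nc_rev b\<close> into the
        left radical.\<close>
      have "nc_rev (nc_mult (nc_rev a) b) = nc_mult (nc_rev b) a" by (simp add: nc_rev_mult)
      then have "\<sigma> (nc_rev b) a = nc_eval (nc_mult (nc_rev a) b) g"
        using rev_eval[of "nc_mult (nc_rev a) b"] that b FA_rev FA_mult unfolding \<sigma>_def by metis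
      then show ?thesis using van FA_rev[OF that] unfolding \<sigma>_def by simp
    qed
    then have "nc_rev b \<in> I" using left FA_rev b by blast
    then show ?thesis using I_rev by fastforce
  qed
  have "quot_fin_dim n I"
    unfolding quot_fin_dim_def
  proof (intro exI[of _ "nc_mono ` N"] conjI ballI)
    show "finite (nc_mono ` N :: 'k nca set)" using fin by simp
    show "nc_mono ` N \<subseteq> (FA n :: 'k nca set)" using NFA by (auto simp: mono_in_FA)
    fix p :: "'k nca" assume "p \<in> FA n"
    then obtain c where c: "nc_sub p (\<lambda>w. \<Sum>u\<in>N. c u * nc_mono u w) \<in> I"
      using span_by_words[OF fin red] by blast
    \<comment> \<open>Finite dimension is stated with coefficients indexed by polynomials instead of
      words, so the sum is reindexed along \<open>nc_mono\<close>.\<close>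
    have inj: "inj (nc_mono :: nat list \<Rightarrow> 'k nca)"
      by (rule injI) (metis nc_mono_def zero_neq_one)
    have "(\<Sum>b\<in>nc_mono ` N. c (inv nc_mono b) * b w) = (\<Sum>u\<in>N. c u * nc_mono u w)" for w
      by (subst sum.reindex) (auto intro: inj_on_subset[OF inj] simp: inv_f_f[OF inj])
    with c show "\<exists>c. nc_sub p (\<lambda>w. \<Sum>b\<in>nc_mono ` N. c b * b w) \<in> I"
      by (intro exI[of _ "\<lambda>b. c (inv nc_mono b)"]) simp
  qed
  moreover have "\<sigma> (nc_add a b) c = \<sigma> a c + \<sigma> b c \<and> \<sigma> c (nc_add a b) = \<sigma> c a + \<sigma> c b"
    if "a \<in> FA n" "b \<in> FA n" "c \<in> FA n" for a b c
  proof -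
    have "nc_mult (nc_add a b) c = nc_add (nc_mult a c) (nc_mult b c)"
      by (auto simp: nc_mult_def nc_add_def distrib_right sum.distrib)
    then show ?thesis
      using that[THEN FA_fin_supp] by (simp add: \<sigma>_def nc_eval_add nc_mult_add_right)
  qed
  moreover have "\<sigma> (nc_smult s a) b = s * \<sigma> a b \<and> \<sigma> a (nc_smult s b) = s * \<sigma> a b"
    if "a \<in> FA n" "b \<in> FA n" for a b s
    using that[THEN FA_fin_supp] by (simp add: \<sigma>_def nc_mult_smult_left nc_mult_smult_right nc_eval_smult)
  moreover have "\<sigma> a b = 0 \<and> \<sigma> b a = 0" if "a \<in> I" "b \<in> FA n" for a b
    unfolding \<sigma>_def using that by (simp add: I_eval lmult rmult)
  moreover have "\<sigma> (nc_mult a b) c = \<sigma> a (nc_mult b c)"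
    if "a \<in> FA n" "b \<in> FA n" "c \<in> FA n" for a b c
    using that[THEN FA_fin_supp] by (simp add: \<sigma> nc_eval_mult)
  ultimately show ?thesis
    unfolding quot_Frobenius_def using left right by blast
qed

end

section \<open>Words in a nil-Coxeter algebra of type A\<close>

text \<open>With letter \<open>i\<close> read as the transposition of \<open>i\<close> and
  \<open>i + 1\<close>, the words with \<open>1 \<le> k \<le> m + 1\<close> are the minimal
  representatives of the cosets of S_m in S_(m+1); the last one is empty.\<close>

definition desc :: "nat \<Rightarrow> nat \<Rightarrow> nat list" where
  "desc m k = rev [k..<Suc m]"

lemma set_desc [simp]: "set (desc m k) = {k..m}"
  by (auto simp: desc_def)

lemma desc_empty [simp]: "m < k \<Longrightarrow> desc m k = []"
  by (simp add: desc_def)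

lemma desc_Cons: "k \<le> Suc m \<Longrightarrow> desc (Suc m) k = Suc m # desc m k"
  by (simp add: desc_def)

lemma desc_append:
  assumes "1 \<le> k" "k \<le> j" "j \<le> Suc m"
  shows "desc m j @ desc (j - 1) k = desc m k"
proof -
  have "[k..<j] @ [j..<Suc m] = [k..<Suc m]"
    using upt_add_eq_append[of k j "Suc m - j"] assms by simp
  then show ?thesis
    using assms unfolding desc_def by (metis Suc_pred' le_trans less_eq_Suc_le One_nat_def rev_append)
qed

lemma desc_snoc: "k \<le> m \<Longrightarrow> desc m k = desc m (Suc k) @ [k]"
  unfolding desc_def by (subst upt_conv_Cons) auto

text \<open>Products of coset representatives along the chain of symmetric groups: the canonical
  reduced words of S_(m+1). The largest \<open>k\<close> gives an empty factor.\<close>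

primrec normal_words :: "nat \<Rightarrow> nat list set" where
  "normal_words 0 = {[]}"
| "normal_words (Suc m) = (\<lambda>(u, k). u @ desc (Suc m) k) ` (normal_words m \<times> {1..m + 2})"

text \<open>The longest coset representative is chosen in every factor.\<close>

primrec longest_word :: "nat \<Rightarrow> nat list" where
  "longest_word 0 = []"
| "longest_word (Suc m) = longest_word m @ desc (Suc m) 1"

lemma finite_normal_words: "finite (normal_words m)"
  by (induction m) auto

lemma set_normal_words: "u \<in> normal_words m \<Longrightarrow> set u \<subseteq> {1..m}"
  by (induction m arbitrary: u) fastforce+

lemma longest_word_normal: "longest_word m \<in> normal_words m"
  by (induction m) (auto intro!: image_eqI[of _ _ "(longest_word _, 1)"])

lemma set_longest_word: "set (longest_word m) \<subseteq> {1..m}"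
  using longest_word_normal set_normal_words by blast

text \<open>Squares vanish only up to \<open>m\<close>, while the other relations hold up to
  \<open>n\<close>. This covers \<open>d = 2\<close> with \<open>m = n\<close> as well as larger
  \<open>d\<close> with \<open>m = n - 1\<close>.\<close>

locale nil_coxeter_ideal = nc_two_sided_ideal +
  fixes m :: nat
  assumes m_le: "m \<le> n"
    and braid: "1 \<le> i \<Longrightarrow> Suc i \<le> n \<Longrightarrow> [i, Suc i, i] \<approx> [Suc i, i, Suc i]"
    and commute: "i \<in> {1..n} \<Longrightarrow> j \<in> {1..n} \<Longrightarrow> Suc i < j \<or> Suc j < i \<Longrightarrow> [i, j] \<approx> [j, i]"
    and square: "i \<in> {1..m} \<Longrightarrow> vanishes [i, i]"
begin

section \<open>Rewriting words into normal form\<close>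

lemma commute_word:
  assumes "i \<in> {1..n}" "set u \<subseteq> {1..n}" "\<And>j. j \<in> set u \<Longrightarrow> Suc i < j \<or> Suc j < i"
  shows "u @ [i] \<approx> i # u"
  using assms(2,3)
proof (induction u)
  case (Cons j u)
  have "[j] @ (u @ [i]) \<approx> [j] @ (i # u)"
    using Cons by (intro cong_append_left) auto
  also have "[j] @ (i # u) = [j, i] @ u" by simp
  also have "[j, i] @ u \<approx> [i, j] @ u"
    using Cons assms(1) by (intro cong_append_right commute) auto
  finally show ?case by simp
qed simp

lemma desc_mult_eq:
  assumes "1 \<le> k" "k \<le> l" "l \<le> m"
  shows "vanishes (desc l k @ [k])"
proof -
  have "vanishes (desc l (Suc k) @ [k, k])"
    using assms m_le by (intro vanishes_append_left square) auto
  then show ?thesis using assms by (simp add: desc_snoc[of k l])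
qed

lemma desc_mult_below:
  assumes "1 \<le> i" "Suc i < k" "k \<le> Suc l" "l \<le> n"
  shows "desc l k @ [i] \<approx> i # desc l k"
  using assms by (intro commute_word) auto

text \<open>The letter \<open>Suc i\<close> commutes leftwards past the letters below
  \<open>i\<close>, braids with the block \<open>Suc i, i\<close>, and leaves on the left a letter
  \<open>i\<close> that commutes past the letters above \<open>Suc i\<close>. So it crosses the word
  and drops by one.\<close>

lemma desc_mult_above:
  assumes "1 \<le> k" "k < Suc i" "Suc i \<le> l" "l \<le> n"
  shows "desc l k @ [Suc i] \<approx> i # desc l k"
proof -
  let ?A = "desc l (Suc (Suc i))" and ?C = "desc (i - 1) k"
  have eq: "desc l k = ?A @ [Suc i, i] @ ?C"
    using assms desc_append[of k "Suc (Suc i)" l] desc_Cons[of k i] desc_Cons[of k "i - 1"] by simp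
  have A: "set ?A \<subseteq> {1..n}" and C: "set ?C \<subseteq> {1..n}" and i: "i \<in> {1..n}" "Suc i \<in> {1..n}"
    using assms by auto
  have "(?A @ [Suc i, i]) @ (?C @ [Suc i]) \<approx> (?A @ [Suc i, i]) @ (Suc i # ?C)"
    by (intro cong_append_left commute_word) (use A C i assms in auto)
  also have "\<dots> = ?A @ [Suc i, i, Suc i] @ ?C" by simp
  also have "\<dots> \<approx> ?A @ [i, Suc i, i] @ ?C"
    by (intro cong_context cong_sym[OF braid] A C) (use assms in auto)
  also have "\<dots> = (?A @ [i]) @ ([Suc i, i] @ ?C)" by simp
  also have "\<dots> \<approx> (i # ?A) @ ([Suc i, i] @ ?C)"
    by (intro cong_append_right commute_word) (use A C i assms in auto)
  finally show ?thesis by (simp add: eq)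
qed

text \<open>Compare \<open>i\<close> with the end \<open>k\<close> of the last factor: equality
  gives a square, \<open>i = k - 1\<close> lengthens the factor, and otherwise the letter slides to
  the left of the factor as \<open>i\<close> or \<open>i - 1\<close>, where induction takes
  over.\<close>

lemma normal_words_mult:
  assumes "l \<le> m" "u \<in> normal_words l" "i \<in> {1..l}"
  shows "vanishes (u @ [i]) \<or> (\<exists>u'\<in>normal_words l. u @ [i] \<approx> u')"
  using assms
proof (induction l arbitrary: u i)
  case (Suc l)
  then obtain v k where u: "u = v @ desc (Suc l) k" and v: "v \<in> normal_words l"
    and k: "1 \<le> k" "k \<le> l + 2" by auto
  have v_set: "set v \<subseteq> {1..n}" using set_normal_words[OF v] Suc.prems(1) m_le by auto
  have D_set: "set (desc (Suc l) k) \<subseteq> {1..n}" using k Suc.prems(1) m_le by auto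
  have slide: ?case if "j \<in> {1..l}" and j: "desc (Suc l) k @ [i] \<approx> j # desc (Suc l) k" for j
  proof -
    have "v @ (desc (Suc l) k @ [i]) \<approx> v @ (j # desc (Suc l) k)"
      by (intro cong_append_left j v_set)
    then have *: "u @ [i] \<approx> (v @ [j]) @ desc (Suc l) k" by (simp add: u)
    have "vanishes (v @ [j]) \<or> (\<exists>u'\<in>normal_words l. v @ [j] \<approx> u')"
      using Suc.IH[OF _ v that(1)] Suc.prems(1) by simp
    then show ?thesis
    proof
      assume "vanishes (v @ [j])"
      then show ?thesis using vanishes_cong[OF *] vanishes_append_right D_set by blast
    next
      assume "\<exists>u'\<in>normal_words l. v @ [j] \<approx> u'"
      then obtain u' where u': "u' \<in> normal_words l" "v @ [j] \<approx> u'" by blast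
      have "u @ [i] \<approx> u' @ desc (Suc l) k"
        using cong_trans[OF * cong_append_right[OF u'(2) D_set]] .
      moreover have "u' @ desc (Suc l) k \<in> normal_words (Suc l)"
        using u'(1) k by (auto intro!: image_eqI[of _ _ "(u', k)"])
      ultimately show ?thesis by blast
    qed
  qed
  consider "i = k" | "Suc i = k" | "Suc i < k" | "k < i" by linarith
  then show ?case
  proof cases
    case 1
    then have "vanishes (desc (Suc l) k @ [i])"
      using desc_mult_eq[of k "Suc l"] Suc.prems by auto
    then show ?thesis using vanishes_append_left[OF _ v_set] by (simp add: u)
  next
    case 2
    then have "u @ [i] = v @ desc (Suc l) i"
      using Suc.prems by (simp add: u desc_snoc[of i "Suc l"])
    moreover have "v @ desc (Suc l) i \<in> normal_words (Suc l)"
      using v Suc.prems by (auto intro!: image_eqI[of _ _ "(v, i)"])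
    ultimately show ?thesis by (metis cong_refl)
  next
    case 3
    then show ?thesis
      using desc_mult_below[of i k "Suc l"] Suc.prems m_le k by (intro slide[of i]) auto
  next
    case 4
    then obtain j where "i = Suc j" by (cases i) auto
    then show ?thesis
      using desc_mult_above[of k j "Suc l"] Suc.prems m_le k 4 by (intro slide[of j]) auto
  qed
qed simp

lemma word_reduces:
  assumes "set w \<subseteq> {1..m}"
  shows "vanishes w \<or> (\<exists>u\<in>normal_words m. w \<approx> u)"
  using assms
proof (induction w rule: rev_induct)
  case Nil
  have "[] \<in> normal_words l" for l
    by (induction l) (force simp: image_iff)+
  then show ?case by blast
next
  case (snoc i w)
  have i: "set [i] \<subseteq> {1..n}" using snoc.prems m_le by auto
  have "vanishes w \<or> (\<exists>u\<in>normal_words m. w \<approx> u)" using snoc by simp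
  then show ?case
  proof
    assume "vanishes w"
    then show ?thesis using vanishes_append_right[OF _ i] by blast
  next
    assume "\<exists>u\<in>normal_words m. w \<approx> u"
    then obtain u where u: "u \<in> normal_words m" "w \<approx> u" by blast
    have *: "w @ [i] \<approx> u @ [i]" by (rule cong_append_right[OF u(2) i])
    have "vanishes (u @ [i]) \<or> (\<exists>u'\<in>normal_words m. u @ [i] \<approx> u')"
      using normal_words_mult[OF _ u(1)] snoc.prems by simp
    then show ?thesis using vanishes_cong[OF *] cong_trans[OF *] by blast
  qed
qed

section \<open>Divisors and annihilators of the longest word\<close>

lemma desc_shift:
  assumes "l < n" "set v \<subseteq> {1..l}"
  shows "desc (Suc l) 1 @ map Suc v \<approx> v @ desc (Suc l) 1"
  using assms(2)
proof (induction v)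
  case (Cons i v)
  have v: "set (map Suc v) \<subseteq> {1..n}" and i: "set [i] \<subseteq> {1..n}" using Cons.prems assms(1) by auto
  have "(desc (Suc l) 1 @ [Suc i]) @ map Suc v \<approx> (i # desc (Suc l) 1) @ map Suc v"
    by (intro cong_append_right desc_mult_above v) (use Cons.prems assms(1) in auto)
  also have "\<dots> = [i] @ (desc (Suc l) 1 @ map Suc v)" by simp
  also have "\<dots> \<approx> [i] @ (v @ desc (Suc l) 1)"
    using Cons by (intro cong_append_left i) auto
  finally show ?case by simp
qed simp

lemma normal_word_divides_longest:
  assumes "l \<le> m" "u \<in> normal_words l"
  shows "\<exists>v. set v \<subseteq> {1..l} \<and> u @ v \<approx> longest_word l"
  using assms
proof (induction l arbitrary: u)
  case (Suc l)
  then obtain u' k where u: "u = u' @ desc (Suc l) k" and u': "u' \<in> normal_words l"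
    and k: "1 \<le> k" "k \<le> l + 2" by auto
  obtain v where v: "set v \<subseteq> {1..l}" "u' @ v \<approx> longest_word l"
    using Suc.IH[OF _ u'] Suc.prems(1) by auto
  \<comment> \<open>The first piece completes the last factor of \<open>u\<close> to a full
    descending word. The second is the completion of \<open>u'\<close>, shifted up because each
    letter drops by one on its way left across that full word.\<close>
  let ?v = "desc (k - 1) 1 @ map Suc v"
  have "set ?v \<subseteq> {1..Suc l}" using v(1) k by auto
  moreover have "u @ ?v = u' @ (desc (Suc l) 1 @ map Suc v)"
    using desc_append[of 1 k "Suc l"] k by (simp add: u)
  moreover have "\<dots> \<approx> u' @ (v @ desc (Suc l) 1)"
    by (intro cong_append_left desc_shift v)
       (use set_normal_words[OF u'] Suc.prems(1) m_le in auto)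
  moreover have "\<dots> = (u' @ v) @ desc (Suc l) 1" by simp
  moreover have "\<dots> \<approx> longest_word (Suc l)"
    using cong_append_right[OF v(2), of "desc (Suc l) 1"] Suc.prems(1) m_le by simp
  ultimately show ?case by (metis cong_trans)
qed simp

text \<open>Letter 1 squares with the final letter; any other letter crosses the last factor, drops
  by one and meets the shorter longest word.\<close>

lemma longest_word_mult:
  assumes "l \<le> m" "i \<in> {1..l}"
  shows "vanishes (longest_word l @ [i])"
  using assms
proof (induction l arbitrary: i)
  case (Suc l)
  have L: "set (longest_word l) \<subseteq> {1..n}" using set_longest_word[of l] Suc.prems m_le by auto
  show ?case
  proof (cases "i = 1")
    case True
    then show ?thesis
      using vanishes_append_left[OF desc_mult_eq[of 1 "Suc l"] L] Suc.prems by simp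
  next
    case False
    then obtain j where j: "i = Suc j" "j \<in> {1..l}" using Suc.prems by (cases i) auto
    have "longest_word l @ (desc (Suc l) 1 @ [i]) \<approx> longest_word l @ (j # desc (Suc l) 1)"
      unfolding j(1) by (intro cong_append_left desc_mult_above L) (use j Suc.prems m_le in auto)
    moreover have "vanishes ((longest_word l @ [j]) @ desc (Suc l) 1)"
      by (intro vanishes_append_right Suc.IH) (use j Suc.prems m_le in auto)
    ultimately show ?thesis using vanishes_cong by simp
  qed
qed simp

text \<open>Letters below \<open>n\<close> are absorbed by the longest word. For letter
  \<open>n\<close>, everything except the single \<open>n - 1\<close> in the longest word that
  begins its last factor commutes with \<open>n\<close>, which leaves the factor
  \<open>n n (n-1) n\<close>.\<close>

lemma longest_word_socle:
  assumes m: "m = Suc k" and n: "n = Suc (Suc k)" and i: "i \<in> {1..n}"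
  shows "vanishes (([n, n] @ longest_word (Suc k)) @ [i])"
proof (cases "i = n")
  case False
  then have "vanishes (longest_word (Suc k) @ [i])"
    using i n m by (intro longest_word_mult) auto
  then have "vanishes ([n, n] @ (longest_word (Suc k) @ [i]))"
    by (rule vanishes_append_left) (use n in auto)
  then show ?thesis by simp
next
  case True
  let ?A = "longest_word k" and ?D = "desc k 1"
  have L': "set ?A \<subseteq> {1..k}" by (rule set_longest_word)
  have A: "set ?A \<subseteq> {1..n}" and D: "set ?D \<subseteq> {1..n}" and l: "n \<in> {1..n}" "Suc k \<in> {1..n}"
    using L' n by auto
  have "?A @ [n] \<approx> n # ?A"
    by (rule commute_word) (use A L' l n in auto)
  then have nA: "n # ?A \<approx> ?A @ [n]" by (rule cong_sym)
  have Dn: "?D @ [n] \<approx> n # ?D"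
    by (rule commute_word) (use D l n in auto)
  have br: "[n, Suc k, n] \<approx> [Suc k, n, Suc k]"
    using cong_sym[OF braid[of "Suc k"]] n by simp
  \<comment> \<open>Two braid moves turn \<open>n n (n-1) n\<close> first into
    \<open>n (n-1) n (n-1)\<close> and then into \<open>(n-1) n (n-1) (n-1)\<close>, which contains
    a square.\<close>
  have "vanishes ([Suc k, n] @ [Suc k, Suc k])"
    by (intro vanishes_append_left square) (use l m in auto)
  moreover have "[n] @ [n, Suc k, n] \<approx> [n] @ [Suc k, n, Suc k]"
    by (intro cong_append_left br) (use l in auto)
  moreover have "[n, Suc k, n] @ [Suc k] \<approx> [Suc k, n, Suc k] @ [Suc k]"
    by (intro cong_append_right br) (use l in auto)
  ultimately have core: "vanishes [n, n, Suc k, n]"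
    using vanishes_cong by simp
  have "([n, n] @ ?A @ [Suc k]) @ (?D @ [n]) \<approx> ([n, n] @ ?A @ [Suc k]) @ (n # ?D)"
    by (intro cong_append_left Dn) (use A l in auto)
  also have "\<dots> = [n] @ (n # ?A) @ (Suc k # n # ?D)" by simp
  also have "\<dots> \<approx> [n] @ (?A @ [n]) @ (Suc k # n # ?D)"
    by (intro cong_context nA) (use D l in auto)
  also have "\<dots> = (n # ?A) @ (n # Suc k # n # ?D)" by simp
  also have "\<dots> \<approx> (?A @ [n]) @ (n # Suc k # n # ?D)"
    by (intro cong_append_right nA) (use D l in auto)
  finally have "([n, n] @ longest_word (Suc k)) @ [i] \<approx> ?A @ [n, n, Suc k, n] @ ?D"
    using True by (simp add: desc_Cons)
  then show ?thesis
    using vanishes_cong vanishes_context[OF core A D] by blast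
qed

end

section \<open>The action on permutations\<close>

text \<open>Right multiplication in the nil-Coxeter algebra, where only length-increasing steps
  survive. States are arbitrary functions, so the relations can be checked without an
  invariant.\<close>

definition asc_swap :: "nat \<Rightarrow> (nat \<Rightarrow> nat) \<Rightarrow> (nat \<Rightarrow> nat) option" where
  "asc_swap i f = (if f i < f (Suc i) then Some (f(i := f (Suc i), Suc i := f i)) else None)"

lemma run_asc_swap_braid: "run asc_swap [i, Suc i, i] f = run asc_swap [Suc i, i, Suc i] f"
  by (auto simp: asc_swap_def fun_eq_iff split: Option.bind_split if_splits)

lemma run_asc_swap_commute:
  "Suc i < j \<or> Suc j < i \<Longrightarrow> run asc_swap [i, j] f = run asc_swap [j, i] f"
  by (auto simp: asc_swap_def fun_eq_iff split: Option.bind_split if_splits)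

lemma run_asc_swap_square: "run asc_swap [i, i] f = None"
  by (auto simp: asc_swap_def split: Option.bind_split if_splits)

text \<open>A swap can be undone, so a word together with its final state determines the initial
  state.\<close>

lemma run_asc_swap_inj:
  "run asc_swap w f = Some h \<Longrightarrow> run asc_swap w g = Some h \<Longrightarrow> f = g"
proof (induction w arbitrary: f g)
  case (Cons i w)
  then obtain f' g' where "asc_swap i f = Some f'" "asc_swap i g = Some g'"
    and "run asc_swap w f' = Some h" "run asc_swap w g' = Some h"
    by (auto simp: bind_eq_Some_conv)
  moreover from this Cons.IH have "f' = g'" by blast
  ultimately have *: "f(i := f (Suc i), Suc i := f i) = g(i := g (Suc i), Suc i := g i)"
    by (auto simp: asc_swap_def split: if_splits)
  have "f j = g j" for j
    using fun_cong[OF *, of j] fun_cong[OF *, of i] fun_cong[OF *, of "Suc i"]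
    by (auto split: if_splits)
  then show ?case by auto
qed simp

text \<open>The value at position \<open>m + 1\<close> travels down to position \<open>k\<close> and
  pushes the values it passes up by one; being larger than all of them, it never gets stuck.\<close>

lemma run_desc:
  assumes "k \<le> Suc m" "\<And>j. k \<le> j \<Longrightarrow> j \<le> m \<Longrightarrow> f j < f (Suc m)"
  shows "run asc_swap (desc m k) f =
    Some (\<lambda>j. if j < k \<or> Suc m < j then f j else if j = k then f (Suc m) else f (j - 1))"
  using assms
proof (induction m arbitrary: f)
  case 0
  then show ?case by (cases k) (auto simp: desc_def asc_swap_def fun_eq_iff le_Suc_eq not_less)
next
  case (Suc m)
  show ?case
  proof (cases "k = Suc (Suc m)")
    case True
    then show ?thesis by (auto simp: fun_eq_iff)
  next
    case False
    let ?f = "f(Suc m := f (Suc (Suc m)), Suc (Suc m) := f (Suc m))"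
    have "asc_swap (Suc m) f = Some ?f"
      using Suc.prems(2)[of "Suc m"] Suc.prems(1) False by (auto simp: asc_swap_def)
    moreover have "run asc_swap (desc m k) ?f =
      Some (\<lambda>j. if j < k \<or> Suc m < j then ?f j else if j = k then ?f (Suc m) else ?f (j - 1))"
      using Suc.prems False by (intro Suc.IH) auto
    ultimately show ?thesis
      using Suc.prems(1) False by (auto simp: desc_Cons fun_eq_iff)
  qed
qed

text \<open>The two bounds are the invariant that makes the next value \<open>m + 2\<close>, still
  at its own position, larger than all values it has to pass.\<close>

lemma run_normal_words:
  assumes "u \<in> normal_words m"
  shows "\<exists>f. run asc_swap u id = Some f \<and> (\<forall>j\<le>Suc m. f j \<le> Suc m) \<and> (\<forall>j>Suc m. f j = j)"
  using assms
proof (induction m arbitrary: u)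
  case (Suc m)
  then obtain v k where u: "u = v @ desc (Suc m) k" and v: "v \<in> normal_words m"
    and k: "1 \<le> k" "k \<le> m + 2" by auto
  obtain f where f: "run asc_swap v id = Some f" "\<forall>j\<le>Suc m. f j \<le> Suc m" "\<forall>j>Suc m. f j = j"
    using Suc.IH[OF v] by blast
  have "run asc_swap (desc (Suc m) k) f = Some (\<lambda>j. if j < k \<or> Suc (Suc m) < j then f j
      else if j = k then f (Suc (Suc m)) else f (j - 1))"
    using k f by (intro run_desc) (auto simp: less_Suc_eq_le)
  then have "run asc_swap u id = Some (\<lambda>j. if j < k \<or> Suc (Suc m) < j then f j
      else if j = k then f (Suc (Suc m)) else f (j - 1))" (is "_ = Some ?g")
    using f(1) by (simp add: u run_append del: id_apply)
  moreover have "?g j \<le> Suc (Suc m)" if "j \<le> Suc (Suc m)" for j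
  proof -
    have "f (j - 1) \<le> Suc m" using f(2) that by (simp add: le_diff_conv)
    moreover have "f j \<le> Suc m" if "j < k" using f(2) that k by simp
    ultimately show ?thesis using f(3) by (auto intro: le_SucI)
  qed
  moreover have "?g j = j" if "j > Suc (Suc m)" for j
    using f(3) that by simp
  ultimately show ?case by blast
qed auto

text \<open>The position of the largest value reveals \<open>k\<close>; undoing the last factor then
  leaves the shorter word to the induction.\<close>

lemma inj_on_run_normal_words: "inj_on (\<lambda>u. run asc_swap u id) (normal_words m)"
proof (induction m)
  case (Suc m)
  have max_pos: "\<exists>f g. run asc_swap v id = Some f \<and> run asc_swap (desc (Suc m) k) f = Some g
      \<and> (\<forall>j\<le>m + 2. g j = m + 2 \<longleftrightarrow> j = k)"
    if v: "v \<in> normal_words m" and k: "1 \<le> k" "k \<le> m + 2" for v k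
  proof -
    obtain f where f: "run asc_swap v id = Some f" "\<forall>j\<le>Suc m. f j \<le> Suc m" "\<forall>j>Suc m. f j = j"
      using run_normal_words[OF v] by blast
    have run: "run asc_swap (desc (Suc m) k) f = Some (\<lambda>j. if j < k \<or> Suc (Suc m) < j then f j
        else if j = k then f (Suc (Suc m)) else f (j - 1))"
      using k f by (intro run_desc) (auto simp: less_Suc_eq_le)
    have "f j \<noteq> m + 2" if "j \<le> Suc m" for j
      using f(2) that by fastforce
    moreover have "f (Suc (Suc m)) = m + 2" using f(3) by simp
    ultimately have "(if j < k \<or> Suc (Suc m) < j then f j
        else if j = k then f (Suc (Suc m)) else f (j - 1)) = m + 2 \<longleftrightarrow> j = k" if "j \<le> m + 2" for j
      using that k by (cases "j < k"; cases "j = k"; simp)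
    then show ?thesis using f(1) run by blast
  qed
  show ?case
  proof (rule inj_onI)
    fix u u' assume "u \<in> normal_words (Suc m)" "u' \<in> normal_words (Suc m)"
      and eq: "run asc_swap u id = run asc_swap u' id"
    then obtain v k v' k' where u: "u = v @ desc (Suc m) k" "v \<in> normal_words m" "1 \<le> k" "k \<le> m + 2"
      and u': "u' = v' @ desc (Suc m) k'" "v' \<in> normal_words m" "1 \<le> k'" "k' \<le> m + 2"
      by auto
    obtain f g where f: "run asc_swap v id = Some f" "run asc_swap (desc (Suc m) k) f = Some g"
      "\<forall>j\<le>m + 2. g j = m + 2 \<longleftrightarrow> j = k"
      using max_pos u by blast
    obtain f' g' where f': "run asc_swap v' id = Some f'" "run asc_swap (desc (Suc m) k') f' = Some g'"
      "\<forall>j\<le>m + 2. g' j = m + 2 \<longleftrightarrow> j = k'"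
      using max_pos u' by blast
    have "g = g'" using eq f f' by (simp add: u u' run_append)
    then have "k = k'" using f(3) f'(3) u(4) by blast
    then have "f = f'" using f(2) f'(2) \<open>g = g'\<close> run_asc_swap_inj by blast
    then have "v = v'" using f(1) f'(1) inj_onD[OF Suc.IH _ u(2) u'(2)] by metis
    then show "u = u'" using u u' \<open>k = k'\<close> by simp
  qed
qed simp

definition longest_perm :: "nat \<Rightarrow> nat \<Rightarrow> nat" where
  "longest_perm m j = (if j \<in> {1..Suc m} then m + 2 - j else j)"

lemma run_longest_word: "run asc_swap (longest_word m) id = Some (longest_perm m)"
proof (induction m)
  case 0
  then show ?case by (auto simp: longest_perm_def fun_eq_iff)
next
  case (Suc m)
  have "run asc_swap (desc (Suc m) 1) (longest_perm m) =
    Some (\<lambda>j. if j < 1 \<or> Suc (Suc m) < j then longest_perm m j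
      else if j = 1 then longest_perm m (Suc (Suc m)) else longest_perm m (j - 1))"
    by (rule run_desc) (auto simp: longest_perm_def)
  moreover have "\<dots> = Some (longest_perm (Suc m))"
    by (auto simp: longest_perm_def fun_eq_iff)
  ultimately show ?case
    using Suc by (simp add: run_append)
qed

text \<open>Reading a path of ascending swaps backwards and reversing the order of the values gives
  again a path of ascending swaps.\<close>

lemma run_asc_swap_rev:
  assumes "run asc_swap w f = Some g" "set w \<subseteq> {1..m}" "f ` {1..Suc m} \<subseteq> {1..Suc m}"
  shows "run asc_swap (rev w) (longest_perm m \<circ> g) = Some (longest_perm m \<circ> f)"
  using assms
proof (induction w arbitrary: f)
  case (Cons i w)
  let ?f = "f(i := f (Suc i), Suc i := f i)"
  have i: "i \<in> {1..m}" and lt: "f i < f (Suc i)" and run: "run asc_swap w ?f = Some g"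
    using Cons.prems by (auto simp: asc_swap_def[of i f] split: if_splits)
  have "f j \<in> {1..Suc m}" if "j \<in> {1..Suc m}" for j
    using Cons.prems(3) that by blast
  then have range: "f i \<in> {1..Suc m}" "f (Suc i) \<in> {1..Suc m}"
    using i by auto
  have "?f ` {1..Suc m} \<subseteq> {1..Suc m}"
    using Cons.prems(3) range by auto
  then have IH: "run asc_swap (rev w) (longest_perm m \<circ> g) = Some (longest_perm m \<circ> ?f)"
    by (intro Cons.IH[OF run]) (use Cons.prems in auto)
  have "longest_perm m (f (Suc i)) < longest_perm m (f i)"
    using range lt by (auto simp: longest_perm_def)
  then have "asc_swap i (longest_perm m \<circ> ?f) = Some (longest_perm m \<circ> f)"
    by (auto simp: asc_swap_def fun_eq_iff)
  with IH show ?case by (simp add: run_append del: comp_apply)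
qed simp

text \<open>\<open>longest_perm m\<close> is an involution, so composing with it exchanges the two
  ends of a path from \<open>id\<close> to \<open>longest_perm m\<close>. This makes the functional
  for \<open>d = 2\<close> invariant under reversal.\<close>

lemma run_longest_perm_rev:
  assumes "set w \<subseteq> {1..m}"
  shows "run asc_swap (rev w) id = Some (longest_perm m) \<longleftrightarrow> run asc_swap w id = Some (longest_perm m)"
proof -
  have "longest_perm m \<circ> longest_perm m = id" by (auto simp: longest_perm_def fun_eq_iff)
  then have "run asc_swap (rev v) id = Some (longest_perm m)"
    if "run asc_swap v id = Some (longest_perm m)" "set v \<subseteq> {1..m}" for v
    using run_asc_swap_rev[OF that] by simp
  from this[of w] this[of "rev w"] show ?thesis using assms by auto
qed

section \<open>The algebra NC_A(n,d)\<close>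

lemma NCA_rels_words:
  "(NCA_rels n d :: 'k::field nca set) =
     {nc_sub (nc_mono [i, Suc i, i]) (nc_mono [Suc i, i, Suc i]) | i. 0 < i \<and> i < n}
   \<union> {nc_sub (nc_mono [i, j]) (nc_mono [j, i]) | i j.
        1 \<le> i \<and> i \<le> n \<and> 1 \<le> j \<and> j \<le> n \<and> (i + 1 < j \<or> j + 1 < i)}
   \<union> {nc_mono [i, i] | i. 1 \<le> i \<and> i \<le> n - 1}
   \<union> {nc_mono (replicate d n)}"
  unfolding NCA_rels_def T_def by (simp add: nc_pow_mono numeral_2_eq_2 nc_one_def)

lemma NCA_two_sided: "nc_two_sided_ideal n (NCA_ideal n d)"
  unfolding NCA_ideal_def by unfold_locales (auto intro: nc_ideal.intros)

lemma NCA_nil_coxeter: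
  assumes "m < n \<or> m = n \<and> d = 2"
  shows "nil_coxeter_ideal n (NCA_ideal n d :: 'k::field nca set) m"
proof -
  interpret nc_two_sided_ideal n "NCA_ideal n d :: 'k nca set" by (rule NCA_two_sided)
  have gen: "r \<in> NCA_ideal n d" if "r \<in> NCA_rels n d" for r :: "'k nca"
    using that unfolding NCA_ideal_def by (rule nc_ideal.gen)
  show ?thesis
  proof
    show "m \<le> n" using assms by auto
    show "cong [i, Suc i, i] [Suc i, i, Suc i]" if "1 \<le> i" "Suc i \<le> n" for i
      unfolding cong_def using that by (intro gen) (auto simp: NCA_rels_words)
    show "cong [i, j] [j, i]" if "i \<in> {1..n}" "j \<in> {1..n}" "Suc i < j \<or> Suc j < i" for i j
      unfolding cong_def using that by (intro gen) (auto simp: NCA_rels_words)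
    show "vanishes [i, i]" if "i \<in> {1..m}" for i
    proof -
      \<comment> \<open>If \<open>m = n\<close> and \<open>d = 2\<close>, the square of the last
        letter is the power relation.\<close>
      have "i \<le> n - 1 \<or> replicate d n = [i, i]"
        using that assms by (auto simp: numeral_2_eq_2)
      then show ?thesis
        unfolding vanishes_def using that by (intro gen) (auto simp: NCA_rels_words)
    qed
  qed
qed

text \<open>Checking the defining relations on states suffices to obtain functionals on the
  quotient.\<close>

lemma NCA_eval_run:
  fixes a :: "'k::field nca" and \<phi> :: "'s option \<Rightarrow> 'k"
  assumes a: "a \<in> NCA_ideal n d"
    and braid: "\<And>i s. 0 < i \<Longrightarrow> i < n \<Longrightarrow> run \<delta> [i, Suc i, i] s = run \<delta> [Suc i, i, Suc i] s"
    and commute: "\<And>i j s. 1 \<le> i \<Longrightarrow> Suc i < j \<Longrightarrow> j \<le> n \<Longrightarrow> run \<delta> [i, j] s = run \<delta> [j, i] s"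
    and square: "\<And>i s. 1 \<le> i \<Longrightarrow> i < n \<Longrightarrow> run \<delta> [i, i] s = None"
    and power: "\<And>s. run \<delta> (replicate d n) s = None"
  shows "fin_supp a" "\<phi> None = 0 \<Longrightarrow> nc_eval a (\<lambda>w. \<phi> (run \<delta> w s)) = 0"
proof -
  have "fin_supp a \<and> (\<forall>s (\<phi> :: 's option \<Rightarrow> 'k). \<phi> None = 0 \<longrightarrow> nc_eval a (\<lambda>w. \<phi> (run \<delta> w s)) = 0)"
  proof (rule nc_ideal_eval_run[OF a[unfolded NCA_ideal_def]])
    fix r :: "'k nca" assume r: "r \<in> NCA_rels n d"
    then show "fin_supp r" by (auto simp: NCA_rels_words)
    fix s and \<phi> :: "'s option \<Rightarrow> 'k" assume "\<phi> None = 0"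
    from r consider (braid) i where
          "r = nc_sub (nc_mono [i, Suc i, i]) (nc_mono [Suc i, i, Suc i])" "0 < i" "i < n"
      | (commute) i j where "r = nc_sub (nc_mono [i, j]) (nc_mono [j, i])"
          "1 \<le> i" "i \<le> n" "1 \<le> j" "j \<le> n" "Suc i < j \<or> Suc j < i"
      | (square) i where "r = nc_mono [i, i]" "1 \<le> i" "i < n"
      | (power) "r = nc_mono (replicate d n)"
      unfolding NCA_rels_words by fastforce
    then show "nc_eval r (\<lambda>w. \<phi> (run \<delta> w s)) = 0"
    proof cases
      case braid
      then show ?thesis using assms(2)[of i s] by (simp add: nc_eval_sub)
    next
      case (commute i j)
      then have "run \<delta> [i, j] s = run \<delta> [j, i] s"
        using assms(3)[of i j s] assms(3)[of j i s] by auto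
      then show ?thesis using commute(1) by (simp add: nc_eval_sub del: run.simps)
    next
      case square
      then show ?thesis using assms(4)[of i s] \<open>\<phi> None = 0\<close> by simp
    next
      case power
      then show ?thesis using assms(5)[of s] \<open>\<phi> None = 0\<close> by simp
    qed
  qed
  then show "fin_supp a" "\<phi> None = 0 \<Longrightarrow> nc_eval a (\<lambda>w. \<phi> (run \<delta> w s)) = 0"
    by blast+
qed

text \<open>The words in the braid, square and power relations are palindromes, and a commutation
  relation is reversed into the one with \<open>i\<close> and \<open>j\<close> exchanged.\<close>

lemma NCA_ideal_rev:
  assumes "a \<in> NCA_ideal n d"
  shows "nc_rev a \<in> NCA_ideal n d"
  using assms unfolding NCA_ideal_def
proof (rule nc_ideal_rev)
  fix r :: "'a nca" assume r: "r \<in> NCA_rels n d"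
  show "nc_rev r \<in> NCA_rels n d"
  proof (cases "\<exists>i j. r = nc_sub (nc_mono [i, j]) (nc_mono [j, i]) \<and>
      1 \<le> i \<and> i \<le> n \<and> 1 \<le> j \<and> j \<le> n \<and> (i + 1 < j \<or> j + 1 < i)")
    case True
    then obtain i j where "nc_rev r = nc_sub (nc_mono [j, i]) (nc_mono [i, j])"
      "1 \<le> j \<and> j \<le> n \<and> 1 \<le> i \<and> i \<le> n \<and> (j + 1 < i \<or> i + 1 < j)"
      by (auto simp: nc_rev_sub)
    then show ?thesis unfolding NCA_rels_words by blast
  next
    case False
    with r have "nc_rev r = r" unfolding NCA_rels_words by (auto simp: nc_rev_sub)
    with r show ?thesis by simp
  qed
qed

section \<open>The Frobenius cases\<close>

theorem NCA_Frobenius_nil_coxeter: "quot_Frobenius n (NCA_ideal n 2 :: 'k::field nca set)"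
proof -
  interpret nil_coxeter_ideal n "NCA_ideal n 2 :: 'k nca set" n
    by (rule NCA_nil_coxeter) simp
  let ?\<phi> = "\<lambda>x. if x = Some (longest_perm n) then 1 else 0 :: 'k"
  let ?g = "\<lambda>w. ?\<phi> (run asc_swap w id)"
  have vanish: "fin_supp a" "nc_eval a ?g = 0" if "a \<in> NCA_ideal n 2" for a :: "'k nca"
  proof -
    note rels = run_asc_swap_braid run_asc_swap_commute[OF disjI1] run_asc_swap_square
    have *: "run asc_swap (replicate 2 n) s = None" for s
      using run_asc_swap_square by (simp add: numeral_2_eq_2)
    show "fin_supp a" by (rule NCA_eval_run(1)[OF that rels *])
    show "nc_eval a ?g = 0" by (rule NCA_eval_run(2)[OF that rels *]) simp_all
  qed
  show ?thesis
  proof (rule Frobenius_criterion[OF finite_normal_words[of n] set_normal_words word_reduces vanish])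
    fix u assume u: "u \<in> normal_words n"
    obtain v where v: "set v \<subseteq> {1..n}" "cong (u @ v) (longest_word n)"
      using normal_word_divides_longest[OF _ u] by blast
    \<comment> \<open>The functional kills the ideal, so it takes the same value on congruent
      words.\<close>
    have "?g (u @ v) = ?g (longest_word n)"
      using vanish(2)[OF v(2)[unfolded cong_def]] by (simp add: nc_eval_sub)
    then have uv: "run asc_swap (u @ v) id = Some (longest_perm n)"
      using run_longest_word[of n] by (simp split: if_splits)
    \<comment> \<open>Running \<open>v\<close> backwards from the longest permutation gives one
      state only, and distinct normal words reach distinct states.\<close>
    have uniq: "u' = u" if "u' \<in> normal_words n" "run asc_swap (u' @ v) id = Some (longest_perm n)" for u'
    proof -
      from uv that(2) have "run asc_swap u id = run asc_swap u' id"
        unfolding run_append bind_eq_Some_conv using run_asc_swap_inj by metis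
      then show ?thesis using inj_onD[OF inj_on_run_normal_words _ u that(1)] by simp
    qed
    have "?g (u' @ v) = (if u' = u then 1 else 0)" if "u' \<in> normal_words n" for u'
      by (cases "u' = u") (use uv uniq[OF that] in \<open>simp, meson\<close>)
    then show "\<exists>v. set v \<subseteq> {1..n} \<and> (\<forall>u'\<in>normal_words n. ?g (u' @ v) = (if u' = u then 1 else 0))"
      using v(1) by blast
  next
    fix w assume "set w \<subseteq> {1..n}"
    then show "?g (rev w) = ?g w" using run_longest_perm_rev by simp
  qed (auto intro: NCA_ideal_rev)
qed

theorem NCA_Frobenius_truncated:
  assumes "d \<ge> 1"
  shows "quot_Frobenius 1 (NCA_ideal 1 d :: 'k::field nca set)"
proof -
  interpret nc_two_sided_ideal 1 "NCA_ideal 1 d :: 'k nca set" by (rule NCA_two_sided)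
  \<comment> \<open>The state is the exponent of T_1, with \<open>d\<close> meaning zero.\<close>
  let ?\<delta> = "\<lambda>(_ :: nat) k. if Suc k < d then Some (Suc k) else None"
  have run: "run ?\<delta> w k = (if w = [] \<or> k + length w < d then Some (k + length w) else None)" for w k
    by (induction w arbitrary: k) auto
  let ?\<phi> = "\<lambda>x. if x = Some (d - 1) then 1 else 0 :: 'k"
  let ?g = "\<lambda>w. ?\<phi> (run ?\<delta> w 0)"
  let ?N = "(\<lambda>k. replicate k 1) ` {..<d}"
  have g: "?g w = (if length w = d - 1 then 1 else 0)" for w
    using assms by (auto simp: run)
  show ?thesis
  proof (rule Frobenius_criterion[of ?N ?g])
    fix w assume "set w \<subseteq> {1..1::nat}"
    then have w: "w = replicate (length w) 1" by (simp add: replicate_eqI subset_eq)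
    have "vanishes (replicate d 1)"
      unfolding vanishes_def unfolding NCA_ideal_def by (intro nc_ideal.gen) (simp add: NCA_rels_words)
    then have "vanishes (replicate d 1 @ replicate (length w - d) 1)"
      by (rule vanishes_append_right) auto
    then have "vanishes w" if "d \<le> length w"
      using that w by (metis le_add_diff_inverse replicate_add)
    then show "vanishes w \<or> (\<exists>u\<in>?N. cong w u)"
      using w by (metis cong_refl image_eqI lessThan_iff not_le)
  next
    fix a :: "'k nca" assume a: "a \<in> NCA_ideal 1 d"
    show "fin_supp a"
      by (rule NCA_eval_run(1)[OF a, where \<delta> = ?\<delta>]) (use assms in \<open>auto simp: run\<close>)
    show "nc_eval a ?g = 0"
      by (rule NCA_eval_run(2)[OF a, where \<delta> = ?\<delta>]) (use assms in \<open>auto simp: run\<close>)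
    show "nc_rev a \<in> NCA_ideal 1 d" by (rule NCA_ideal_rev[OF a])
  next
    fix u :: "nat list" assume "u \<in> ?N"
    then obtain k where k: "u = replicate k 1" "k < d" by auto
    show "\<exists>v. set v \<subseteq> {1..1} \<and> (\<forall>u'\<in>?N. ?g (u' @ v) = (if u' = u then 1 else 0))"
      \<comment> \<open>The complementary power: the lengths add up to \<open>d - 1\<close> for
        exactly one element of \<open>?N\<close>.\<close>
      unfolding g using k by (intro exI[of _ "replicate (d - 1 - k) 1"]) auto
  next
    fix w :: "nat list"
    show "?g (rev w) = ?g w" unfolding g by simp
  qed auto
qed

section \<open>Two independent socle elements\<close>

text \<open>All terms of \<open>b\<close> of positive degree are killed, so only the constant term
  \<open>b []\<close> survives.\<close>

lemma (in nc_two_sided_ideal) annihilated_mult: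
  assumes ann: "\<And>i. i \<in> {1..n} \<Longrightarrow> vanishes (w @ [i])" and b: "b \<in> FA n"
  shows "nc_sub (nc_mult (nc_mono w) b) (nc_smult (b []) (nc_mono w)) \<in> I"
  using b
proof (induction rule: FA_induct)
  case zero
  then show ?case
    using nc_two_sided_ideal.zero[OF nc_two_sided_ideal_axioms]
    by (simp add: nc_mult_def nc_zero_def nc_sub_def nc_smult_def)
next
  case (add c v q)
  let ?q = "nc_sub (nc_mult (nc_mono w) q) (nc_smult (q []) (nc_mono w))"
  have eq: "nc_mult (nc_mono w) (nc_add (nc_smult c (nc_mono v)) q)
      = nc_add (nc_smult c (nc_mono (w @ v))) (nc_mult (nc_mono w) q)"
    by (simp add: nc_mult_add_right nc_mult_smult_right)
  show ?case
  proof (cases v)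
    case Nil
    then have "nc_sub (nc_mult (nc_mono w) (nc_add (nc_smult c (nc_mono v)) q))
        (nc_smult (nc_add (nc_smult c (nc_mono v)) q []) (nc_mono w)) = ?q"
      unfolding eq by (simp add: nc_sub_def nc_add_def nc_smult_def nc_mono_def fun_eq_iff algebra_simps)
    then show ?thesis using add.IH by simp
  next
    case (Cons i v')
    have "vanishes (w @ v)"
      using vanishes_append_right[OF ann[of i], of v'] Cons add.hyps(1) by simp
    then have "nc_add (nc_smult c (nc_mono (w @ v))) ?q \<in> I"
      unfolding vanishes_def
      by (intro nc_two_sided_ideal.add[OF nc_two_sided_ideal_axioms] smult add.IH)
    moreover have "nc_sub (nc_mult (nc_mono w) (nc_add (nc_smult c (nc_mono v)) q))
        (nc_smult (nc_add (nc_smult c (nc_mono v)) q []) (nc_mono w))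
        = nc_add (nc_smult c (nc_mono (w @ v))) ?q"
      unfolding eq using Cons
      by (simp add: nc_sub_def nc_add_def nc_smult_def nc_mono_def fun_eq_iff)
    ultimately show ?thesis by simp
  qed
qed

text \<open>The states \<open>(t, f)\<close> record how far a word has read the prefix \<open>T_(n-1) T_n T_n\<close>: from stage 3 on
  the letters below \<open>n\<close> act on \<open>f\<close> freely, before that only the letters commuting with the
  unread part of the prefix do.\<close>

definition staged_swap :: "nat \<Rightarrow> nat \<Rightarrow> nat \<times> (nat \<Rightarrow> nat) \<Rightarrow> (nat \<times> (nat \<Rightarrow> nat)) option" where
  "staged_swap n i = (\<lambda>(t, f).
     if i = n then (if t = 1 \<or> t = 2 then Some (Suc t, f) else None)
     else if Suc i = n \<and> t = 0 then Some (1, f)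
     else if Suc i = n \<and> t < 3 \<or> Suc (Suc i) = n \<and> t = 0 then None
     else map_option (Pair t) (asc_swap i f))"

text \<open>For \<open>i = n - 1\<close> both sides kill every state: \<open>n\<close> acts only at
  stages 1 and 2, and \<open>n - 1\<close> only at stage 0 and from stage 3 on.\<close>

lemma staged_swap_braid:
  "i < n \<Longrightarrow> run (staged_swap n) [i, Suc i, i] s = run (staged_swap n) [Suc i, i, Suc i] s"
  by (cases s)
     (auto simp: staged_swap_def asc_swap_def fun_eq_iff split: Option.bind_split if_splits)

lemma staged_swap_commute:
  "Suc i < j \<Longrightarrow> j \<le> n \<Longrightarrow> run (staged_swap n) [i, j] s = run (staged_swap n) [j, i] s"
  by (cases s)
     (auto simp: staged_swap_def asc_swap_def fun_eq_iff split: Option.bind_split if_splits)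

lemma staged_swap_square: "i < n \<Longrightarrow> run (staged_swap n) [i, i] s = None"
  by (cases s) (auto simp: staged_swap_def asc_swap_def split: Option.bind_split if_splits)

text \<open>Letter \<open>n\<close> acts only at stages 1 and 2 and raises the stage each time, so
  no state survives three of them.\<close>

lemma staged_swap_power:
  assumes "d \<ge> 3"
  shows "run (staged_swap n) (replicate d n) s = None"
proof -
  have "run (staged_swap n) (replicate 3 n) s = None"
    by (cases s) (auto simp: staged_swap_def numeral_3_eq_3 split: Option.bind_split if_splits)
  then have "run (staged_swap n) (replicate 3 n @ replicate (d - 3) n) s = None"
    by (simp add: run_append)
  then show ?thesis using assms by (simp flip: replicate_add)
qed

lemma run_staged_swap_last:
  "set w \<subseteq> {1..<n} \<Longrightarrow> run (staged_swap n) w (3, f) = map_option (Pair 3) (run asc_swap w f)"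
  by (induction w arbitrary: f) (auto simp: staged_swap_def split: Option.bind_split)

theorem NCA_not_Frobenius:
  assumes "n \<ge> 2" "d \<ge> 3"
  shows "\<not> quot_Frobenius n (NCA_ideal n d :: 'k::field nca set)"
proof
  let ?I = "NCA_ideal n d :: 'k nca set"
  assume "quot_Frobenius n ?I"
  then obtain \<sigma> :: "'k nca \<Rightarrow> 'k nca \<Rightarrow> 'k" where
    \<sigma>_add: "\<And>a b c. a \<in> FA n \<Longrightarrow> b \<in> FA n \<Longrightarrow> c \<in> FA n \<Longrightarrow>
      \<sigma> (nc_add a b) c = \<sigma> a c + \<sigma> b c \<and> \<sigma> c (nc_add a b) = \<sigma> c a + \<sigma> c b"
    and \<sigma>_smult: "\<And>a b s. a \<in> FA n \<Longrightarrow> b \<in> FA n \<Longrightarrow>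
      \<sigma> (nc_smult s a) b = s * \<sigma> a b \<and> \<sigma> a (nc_smult s b) = s * \<sigma> a b"
    and \<sigma>_I: "\<And>a b. a \<in> ?I \<Longrightarrow> b \<in> FA n \<Longrightarrow> \<sigma> a b = 0 \<and> \<sigma> b a = 0"
    and \<sigma>_assoc: "\<And>a b c. a \<in> FA n \<Longrightarrow> b \<in> FA n \<Longrightarrow> c \<in> FA n \<Longrightarrow>
      \<sigma> (nc_mult a b) c = \<sigma> a (nc_mult b c)"
    and \<sigma>_nondeg: "\<And>a. a \<in> FA n \<Longrightarrow> (\<And>b. b \<in> FA n \<Longrightarrow> \<sigma> a b = 0) \<Longrightarrow> a \<in> ?I"
    unfolding quot_Frobenius_def
  proof (elim conjE exE, goal_cases)
    case (1 \<sigma>)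
    then show thesis by (intro 1(1)[of \<sigma>]) blast+
  qed
  obtain k where n: "n = Suc (Suc k)" using assms(1) by (metis add_2_eq_Suc le_Suc_ex)
  interpret nil_coxeter_ideal n ?I "Suc k"
    by (rule NCA_nil_coxeter) (simp add: n)
  let ?x = "[n, n] @ longest_word (Suc k)" and ?y = "Suc k # [n, n] @ longest_word (Suc k)"
  have L: "set (longest_word (Suc k)) \<subseteq> {1..n}"
    using set_longest_word[of "Suc k"] n by auto
  have x: "set ?x \<subseteq> {1..n}" and y: "set ?y \<subseteq> {1..n}" using L n by auto

  have ann_x: "vanishes (?x @ [i])" if "i \<in> {1..n}" for i
    using longest_word_socle[OF refl n that] .
  have ann_y: "vanishes (?y @ [i])" if "i \<in> {1..n}" for i
    using vanishes_append_left[OF ann_x[OF that], of "[Suc k]"] n by simp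

  \<comment> \<open>On an element killed by all generators from the right, associativity reduces the
    form to one scalar, its pairing with 1.\<close>
  have socle: "\<sigma> (nc_mono w) b = b [] * \<sigma> nc_one (nc_mono w)"
    if w: "set w \<subseteq> {1..n}" and ann: "\<And>i. i \<in> {1..n} \<Longrightarrow> vanishes (w @ [i])" and b: "b \<in> FA n"
    for w b
  proof -
    have FA: "nc_one \<in> (FA n :: 'k nca set)" "nc_mono w \<in> (FA n :: 'k nca set)"
      using w by (auto simp: nc_one_def mono_in_FA)
    have FA': "nc_mult (nc_mono w) b \<in> FA n" "nc_smult (b []) (nc_mono w) \<in> FA n"
      using FA b by (auto intro: FA_mult FA_smult)
    have "\<sigma> nc_one (nc_sub (nc_mult (nc_mono w) b) (nc_smult (b []) (nc_mono w))) = 0"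
      using \<sigma>_I[OF annihilated_mult[OF ann b] FA(1)] by blast
    then have "\<sigma> nc_one (nc_mult (nc_mono w) b) = b [] * \<sigma> nc_one (nc_mono w)"
      using FA FA' by (simp add: nc_sub_eq \<sigma>_add \<sigma>_smult FA_smult)
    moreover have "\<sigma> (nc_mult nc_one (nc_mono w)) b = \<sigma> nc_one (nc_mult (nc_mono w) b)"
      using FA b by (intro \<sigma>_assoc) auto
    moreover have "nc_mult nc_one (nc_mono w) = (nc_mono w :: 'k nca)"
      by (simp add: nc_one_def)
    ultimately show ?thesis by simp
  qed

  \<comment> \<open>This functional separates the two elements: \<open>?x\<close> starts with
    \<open>n\<close>, which is dead at stage 0, while \<open>?y\<close> reads the full prefix and
    then the longest word.\<close>
  let ?\<phi> = "\<lambda>s. if s = Some (3, longest_perm (Suc k)) then 1 else 0 :: 'k"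
  let ?g = "\<lambda>w. ?\<phi> (run (staged_swap n) w (0, id))"
  have vanish: "nc_eval a ?g = 0" if "a \<in> ?I" for a
    by (rule NCA_eval_run(2)[OF that staged_swap_braid staged_swap_commute staged_swap_square
          staged_swap_power]) (use assms in auto)
  have "run (staged_swap n) (longest_word (Suc k)) (3, id) = Some (3, longest_perm (Suc k))"
    using set_longest_word[of "Suc k"] n
    by (subst run_staged_swap_last) (auto simp: run_longest_word simp del: longest_word.simps)
  moreover have "staged_swap n n (0, id) = None" "staged_swap n (Suc k) (0, id) = Some (1, id)"
    "staged_swap n n (1, id) = Some (2, id)" "staged_swap n n (2, id) = Some (3, id)"
    by (auto simp: staged_swap_def n)
  ultimately have g: "?g ?x = 0" "?g ?y = 1"
    by (simp_all del: longest_word.simps id_apply)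
  have y_notin: "nc_mono ?y \<notin> ?I" using vanish[of "nc_mono ?y"] g(2) by auto

  let ?sx = "\<sigma> nc_one (nc_mono ?x)" and ?sy = "\<sigma> nc_one (nc_mono ?y)"
  \<comment> \<open>The combination of \<open>?x\<close> and \<open>?y\<close> whose pairing with 1
    is zero; by \<open>socle\<close> it lies in the left radical.\<close>
  let ?e = "nc_sub (nc_smult ?sy (nc_mono ?x)) (nc_smult ?sx (nc_mono ?y))"
  have FA: "nc_mono ?x \<in> (FA n :: 'k nca set)" "nc_mono ?y \<in> (FA n :: 'k nca set)"
    using x y by (simp_all only: mono_in_FA)
  have "?e \<in> ?I"
  proof (rule \<sigma>_nondeg)
    show "?e \<in> FA n" unfolding nc_sub_eq using FA by (intro FA_add FA_smult)
    show "\<sigma> ?e b = 0" if "b \<in> FA n" for b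
      using FA that socle[OF x ann_x that] socle[OF y ann_y that]
      by (simp only: nc_sub_eq \<sigma>_add \<sigma>_smult FA_smult) simp
  qed
  then have "nc_eval ?e ?g = 0" by (rule vanish)
  \<comment> \<open>The functional is 0 on \<open>?x\<close> and 1 on \<open>?y\<close>, so only the
    coefficient of \<open>?y\<close> in \<open>?e\<close> remains. Then \<open>?x\<close> itself is
    in the radical, which forces its left multiple \<open>?y\<close> into the ideal.\<close>
  then have "?sx = 0" using g by (simp add: nc_eval_sub nc_eval_smult del: run.simps append.simps)
  then have "nc_mono ?x \<in> ?I"
    using socle[OF x ann_x] by (intro \<sigma>_nondeg FA) simp
  then have "vanishes ?x" by (simp only: vanishes_def)
  then have "vanishes ([Suc k] @ ?x)"
    by (rule vanishes_append_left) (use n in simp)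
  with y_notin show False by (simp add: vanishes_def)
qed

theorem theorem5p2:
  fixes n d :: nat
  assumes "n \<ge> 1" and "d \<ge> 2"
  shows "quot_Frobenius n (NCA_ideal n d :: 'k::field nca set) \<longleftrightarrow> (n = 1 \<or> d = 2)"
proof
  assume "quot_Frobenius n (NCA_ideal n d :: 'k nca set)"
  then show "n = 1 \<or> d = 2"
    using NCA_not_Frobenius[of n d] assms by force
next
  assume "n = 1 \<or> d = 2"
  then show "quot_Frobenius n (NCA_ideal n d :: 'k nca set)"
    using NCA_Frobenius_truncated[of d] NCA_Frobenius_nil_coxeter[of n] assms by auto
qed

end
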